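(* Let $\{(N_k,B_k)\}_{k=1}^\infty$ be a sequence of admissible pairs. Suppose that the infinite convolution $$\mu = \delta_{N_{1}^{-1} B_1} * \delta_{(N_1 N_2)^{-1} B_2} * \cdots * \delta_{(N_1 N_2 \cdots N_k)^{-1} B_k } * \cdots$$ exists (as the weak limit of its finite partial convolutions), and for $n\ge 1$ let $$\nu_{>n}=\delta_{N_{n+1}^{-1} B_{n+1}} * \delta_{(N_{n+1} N_{n+2})^{-1} B_{n+2}} * \cdots .$$ If there exist a subsequence $\{\nu_{>n_j}\}_{j\ge 1}$ of $\{\nu_{>n}\}$ and a Borel probability measure $\nu$ on $\mathbb{R}$ such that $\nu_{>n_j}$ converges weakly to $\nu$, and $\mathcal{Z}(\nu)=\emptyset$, then $\mu$ is a spectral measure with a spectrum contained in $\mathbb{Z}$.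
   Context: For a finite nonempty set $A\subset\mathbb{R}$, $\delta_A=\frac{1}{\#A}\sum_{a\in A}\delta_a$, where $\delta_a$ is the Dirac measure at $a$; $cA=\{ca: a\in A\}$. A Borel probability measure $\mu$ on $\mathbb{R}$ is a spectral measure if there is a set $\Lambda\subset\mathbb{R}$, called a spectrum of $\mu$, such that $\{e^{2\pi i\lambda x}:\lambda\in\Lambda\}$ is an orthonormal basis of $L^2(\mu)$. Given an integer $N$ with $|N|\ge 2$ and a finite set $B\subset\mathbb{Z}$ with $\#B\ge 2$, $(N,B)$ is an admissible pair if the discrete measure $\delta_{N^{-1}B}$ admits a spectrum $L\subset\mathbb{Z}$, i.e. the matrix $\left(\frac{1}{\sqrt{\#B}}e^{-2\pi i b\ell/N}\right)_{b\in B,\ell\in L}$ is unitary. An infinite convolution exists if the finite partial convolutions $\mu_n=\delta_{N_{1}^{-1} B_1} * \cdots * \delta_{(N_1 \cdots N_n)^{-1} B_n }$ converge weakly (against bounded continuous functions) to a Borel probability measure, which is then the infinite convolution. Writing $\mu=\mu_n*\mu_{>n}$ with $\mu_{>n}$ the tail convolution $\delta_{(N_1\cdots N_{n+1})^{-1}B_{n+1}}*\delta_{(N_1\cdots N_{n+2})^{-1}B_{n+2}}*\cdots$, one has $\nu_{>n}(\cdot)=\mu_{>n}\left(\frac{1}{N_1N_2\cdots N_n}\,\cdot\right)$. The Fourier transform is $\widehat{\nu}(\xi)=\int_{\mathbb{R}}e^{-2\pi i\xi x}\,d\nu(x)$, and the integral periodic zero set of $\nu$ is $\mathcal{Z}(\nu)=\{\xi\in\mathbb{R}:\widehat{\nu}(\xi+k)=0\text{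 for all }k\in\mathbb{Z}\}$. *)

theory Defs
  imports "HOL-Probability.Probability"
begin

section \<open>Discrete measures and weak convergence\<close>

definition discrete_uniform :: "real set \<Rightarrow> real measure" where
  "discrete_uniform A = distr (measure_pmf (pmf_of_set A)) borel (\<lambda>x. x)"

text \<open>For finite nonempty \<open>A\<close> this is the average of the Dirac measures at the points of \<open>A\<close>.\<close>

lemma emeasure_discrete_uniform:
  assumes "finite A" "A \<noteq> {}" "X \<in> sets borel"
  shows "emeasure (discrete_uniform A) X = (\<Sum>a\<in>A. emeasure (return borel a) X) / of_nat (card A)"
proof -
  have "(\<Sum>a\<in>A. emeasure (return borel a) X) = (\<Sum>a\<in>A. indicator X a)"
    using assms(3) by simp
  also have "\<dots> = (of_nat (card (A \<inter> X)) :: ennreal)"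
    using assms(1) by (simp add: indicator_def sum.If_cases)
  finally have *: "(\<Sum>a\<in>A. emeasure (return borel a) X) = (of_nat (card (A \<inter> X)) :: ennreal)" .
  have "card A > 0"
    using assms(1,2) by (simp add: card_gt_0_iff)
  then show ?thesis
    unfolding * discrete_uniform_def using assms
    by (simp add: emeasure_distr emeasure_pmf_of_set divide_ennreal Int_commute ennreal_of_nat_eq_real_of_nat)
qed

definition weakly_converges :: "(nat \<Rightarrow> real measure) \<Rightarrow> real measure \<Rightarrow> bool" where
  "weakly_converges M \<mu> \<longleftrightarrow>
     (\<forall>f :: real \<Rightarrow> real. continuous_on UNIV f \<longrightarrow> bounded (range f) \<longrightarrow>
        (\<lambda>n. \<integral>x. f x \<partial>M n) \<longlonglongrightarrow> (\<integral>x. f x \<partial>\<mu>))"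

lemma weakly_converges_iff_weak_conv_m:
  assumes "\<And>n. real_distribution (M n)" "real_distribution \<mu>"
  shows "weakly_converges M \<mu> \<longleftrightarrow> weak_conv_m M \<mu>"
proof
  assume *: "weakly_converges M \<mu>"
  show "weak_conv_m M \<mu>"
  proof (rule integral_bdd_continuous_conv_imp_weak_conv[OF assms])
    fix f :: "real \<Rightarrow> real" and b
    assume "\<And>x. isCont f x" "\<And>x. abs (f x) \<le> b"
    then show "(\<lambda>n. \<integral>x. f x \<partial>M n) \<longlonglongrightarrow> (\<integral>x. f x \<partial>\<mu>)"
      using * unfolding weakly_converges_def
      by (metis boundedI continuous_at_imp_continuous_on imageE real_norm_def)
  qed
next
  assume *: "weak_conv_m M \<mu>"
  show "weakly_converges M \<mu>"
    unfolding weakly_converges_def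
  proof (intro allI impI)
    fix f :: "real \<Rightarrow> real"
    assume f: "continuous_on UNIV f" "bounded (range f)"
    then obtain b where "\<And>x. norm (f x) \<le> b"
      by (auto simp: bounded_iff)
    moreover have "isCont f x" for x
      using f(1) by (simp add: continuous_on_eq_continuous_at)
    ultimately show "(\<lambda>n. \<integral>x. f x \<partial>M n) \<longlonglongrightarrow> (\<integral>x. f x \<partial>\<mu>)"
      by (intro weak_conv_imp_integral_bdd_continuous_conv[OF assms *])
  qed
qed

section \<open>Infinite convolutions\<close>

text \<open>Factors are indexed from 1; the Dirac measure at 0 is the empty convolution.\<close>

primrec partial_convolution :: "(nat \<Rightarrow> real measure) \<Rightarrow> nat \<Rightarrow> real measure" where
  "partial_convolution M 0 = return borel 0"
| "partial_convolution M (Suc n) = (partial_convolution M n \<star> M (Suc n))"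

definition has_infinite_convolution :: "(nat \<Rightarrow> real measure) \<Rightarrow> real measure \<Rightarrow> bool" where
  "has_infinite_convolution M \<mu> \<longleftrightarrow>
     real_distribution \<mu> \<and> weakly_converges (partial_convolution M) \<mu>"

definition infinite_convolution :: "(nat \<Rightarrow> real measure) \<Rightarrow> real measure" where
  "infinite_convolution M = (THE \<mu>. has_infinite_convolution M \<mu>)"

lemma infinite_convolution_eqI:
  assumes "\<And>k. k \<ge> 1 \<Longrightarrow> real_distribution (M k)" "has_infinite_convolution M \<mu>"
  shows "infinite_convolution M = \<mu>"
proof -
  have partial: "real_distribution (partial_convolution M n)" for n
  proof (induction n)
    case 0
    show ?case
      by (simp add: real_distribution_def real_distribution_axioms_def prob_space_return)
  next
    case (Suc n)
    interpret L: real_distribution "partial_convolution M n" by fact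
    interpret R: real_distribution "M (Suc n)" by (rule assms(1)) simp
    interpret pair: pair_prob_space "partial_convolution M n" "M (Suc n)" ..
    have "(\<lambda>(x, y). x + y) \<in> borel_measurable (partial_convolution M n \<Otimes>\<^sub>M M (Suc n))"
      by measurable
    then show ?case
      unfolding partial_convolution.simps convolution_def by (rule pair.P.real_distribution_distr)
  qed
  have char_lim: "(\<lambda>n. char (partial_convolution M n) t) \<longlonglongrightarrow> char \<rho> t"
    if "has_infinite_convolution M \<rho>" for \<rho> t
    using that partial levy_continuity1 weakly_converges_iff_weak_conv_m
    unfolding has_infinite_convolution_def by blast
  show ?thesis
    unfolding infinite_convolution_def
  proof (rule the_equality)
    show "has_infinite_convolution M \<mu>" by fact
  next
    fix \<rho> assume \<rho>: "has_infinite_convolution M \<rho>"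
    have "char \<rho> = char \<mu>"
      using char_lim[OF \<rho>] char_lim[OF assms(2)] by (blast intro: LIMSEQ_unique)
    then show "\<rho> = \<mu>"
      using \<rho> assms(2) by (simp add: Levy_uniqueness has_infinite_convolution_def)
  qed
qed

text \<open>
  The \<open>k\<close>-th factor (\<open>k \<ge> 1\<close>) of the convolution started after position \<open>n\<close>: the uniform measure
  on \<open>(N\<^sub>n\<^sub>+\<^sub>1 \<dots> N\<^sub>n\<^sub>+\<^sub>k)\<^sup>-\<^sup>1 B\<^sub>n\<^sub>+\<^sub>k\<close>.
\<close>

definition tail_factor :: "(nat \<Rightarrow> int) \<Rightarrow> (nat \<Rightarrow> int set) \<Rightarrow> nat \<Rightarrow> nat \<Rightarrow> real measure" where
  "tail_factor N B n k =
     discrete_uniform ((\<lambda>b. of_int b / of_int (\<Prod>i=n+1..n+k. N i)) ` B (n + k))"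

section \<open>Spectral measures\<close>

definition square_integrable :: "real measure \<Rightarrow> (real \<Rightarrow> complex) \<Rightarrow> bool" where
  "square_integrable \<mu> f \<longleftrightarrow>
     f \<in> borel_measurable \<mu> \<and> integrable \<mu> (\<lambda>x. (cmod (f x))\<^sup>2)"

definition L2_inner :: "real measure \<Rightarrow> (real \<Rightarrow> complex) \<Rightarrow> (real \<Rightarrow> complex) \<Rightarrow> complex" where
  "L2_inner \<mu> f g = (CLINT x|\<mu>. f x * cnj (g x))"

text \<open>
  An orthonormal basis of the complex space \<open>L\<^sup>2(\<mu>)\<close> is an orthonormal family whose linear span is
  dense.  It is taken as an indexed family: distinct indices give orthogonal functions, so they
  are not allowed to give functions that coincide almost everywhere.
\<close>

definition L2_orthonormal_basis ::
    "real measure \<Rightarrow> 'i set \<Rightarrow> ('i \<Rightarrow> real \<Rightarrow> complex) \<Rightarrow> bool" where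
  "L2_orthonormal_basis \<mu> I e \<longleftrightarrow>
     (\<forall>i\<in>I. square_integrable \<mu> (e i)) \<and>
     (\<forall>i\<in>I. \<forall>j\<in>I. L2_inner \<mu> (e i) (e j) = (if i = j then 1 else 0)) \<and>
     (\<forall>f. square_integrable \<mu> f \<longrightarrow>
        (\<forall>\<epsilon>>0. \<exists>F c. finite F \<and> F \<subseteq> I \<and>
           (\<integral>x. (cmod (f x - (\<Sum>i\<in>F. c i * e i x)))\<^sup>2 \<partial>\<mu>) < \<epsilon>))"

definition is_spectrum :: "real measure \<Rightarrow> real set \<Rightarrow> bool" where
  "is_spectrum \<mu> \<Lambda> \<longleftrightarrow>
     L2_orthonormal_basis \<mu> \<Lambda> (\<lambda>\<xi> x. exp (2 * of_real pi * \<i> * of_real (\<xi> * x)))"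

definition spectral_measure :: "real measure \<Rightarrow> bool" where
  "spectral_measure \<mu> \<longleftrightarrow> real_distribution \<mu> \<and> (\<exists>\<Lambda>. is_spectrum \<mu> \<Lambda>)"

definition admissible_pair :: "int \<Rightarrow> int set \<Rightarrow> bool" where
  "admissible_pair N B \<longleftrightarrow>
     \<bar>N\<bar> \<ge> 2 \<and> finite B \<and> card B \<ge> 2 \<and>
     (\<exists>L. L \<subseteq> \<int> \<and> is_spectrum (discrete_uniform ((\<lambda>b. of_int b / of_int N) ` B)) L)"

section \<open>Fourier transform and integral periodic zero set\<close>

text \<open>The library's \<open>char\<close> uses the kernel \<open>exp (\<i> t x)\<close>, without the factor \<open>-2\<pi>\<close>.\<close>

definition fourier_transform :: "real measure \<Rightarrow> real \<Rightarrow> complex" where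
  "fourier_transform \<nu> \<xi> = (CLINT x|\<nu>. exp (- 2 * of_real pi * \<i> * of_real (\<xi> * x)))"

definition integral_periodic_zero_set :: "real measure \<Rightarrow> real set" where
  "integral_periodic_zero_set \<nu> = {\<xi>. \<forall>k::int. fourier_transform \<nu> (\<xi> + of_int k) = 0}"

end

theory Submission
  imports Defs "HOL-Complex_Analysis.Conformal_Mappings"
begin

text \<open>
  Let \<open>P\<^sub>n\<close> be the product of the first \<open>n\<close> bases, so that the transform of \<open>\<mu>\<close> at \<open>\<xi>\<close> is that of the
  \<open>n\<close>-th partial convolution at \<open>\<xi>\<close> times that of the tail at \<open>\<xi> / P\<^sub>n\<close>.  A finite integer spectrum of a partial
  convolution extends to one of any later partial convolution, and remains a spectrum when its
  elements are moved by multiples of \<open>P\<^sub>n\<close>.  Since the limit \<open>\<nu>\<close> has empty integral periodic zero set,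
  compactness of \<open>[0, 1]\<close> and equicontinuity of the transforms of the tails allow these moves to be
  chosen such that the tail transforms stay above a fixed \<open>\<epsilon> > 0\<close> on the rescaled spectra.  Along a
  nested sequence of such spectra this bound dominates the Parseval sums of the partial convolutions
  by \<open>\<epsilon>\<^sup>-\<^sup>2\<close> times those of \<open>\<mu>\<close>, and Parseval's identity passes to the limit for every exponential.
  Exponentials are total in \<open>L\<^sup>2(\<mu>)\<close>.
\<close>

section \<open>Orthonormal families of square-integrable functions\<close>

text \<open>Orthogonality passes to \<mu> at no cost, because the transform of each partial
  convolution is a factor of that of \<mu>. What can fail is completeness: the Parseval sums of the
  partial convolutions equal 1, but their mass may sit at frequencies where the tail transform is
  nearly zero and so be lost in the limit. Hence the uniform lower bound. Two demands compete in it.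
  Old frequencies must stay fixed, or the spectra would not be nested; they are harmless because
  after division by P_n they approach 0, where the tail transforms stay away from zero. All others
  may be moved, and the hypothesis on \<nu> supplies an integer move for each. The bound is required
  on a whole window of radius \<delta> so that \<epsilon> does not depend on the test frequency
  \<xi>: a fixed \<xi> changes the argument by \<xi> / P_n only, which eventually fits into the
  window. A separate difficulty is that the tails enter through a definite description, so their
  convergence has to be derived from that of \<mu> before anything can be said about them.\<close>

definition wave :: "real \<Rightarrow> real \<Rightarrow> complex" where
  "wave \<xi> x = exp (2 * of_real pi * \<i> * of_real (\<xi> * x))"

lemma norm_wave [simp]: "cmod (wave \<xi> x) = 1"
  by (simp add: wave_def norm_exp_eq_Re)

lemma wave_0 [simp]: "wave 0 x = 1"
  by (simp add: wave_def)

lemma wave_add: "wave (\<xi> + \<eta>) x = wave \<xi> x * wave \<eta> x"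
  by (simp add: wave_def exp_add[symmetric] algebra_simps)

lemma continuous_wave: "continuous_on UNIV (wave \<xi>)"
  unfolding wave_def by (intro continuous_intros)

lemma borel_measurable_wave [measurable]: "wave \<xi> \<in> borel_measurable borel"
  using continuous_wave by (rule borel_measurable_continuous_onI)

lemma square_integrable_bounded:
  assumes "real_distribution \<mu>" "f \<in> borel_measurable borel" "\<And>x. cmod (f x) \<le> C"
  shows "square_integrable \<mu> f"
proof -
  interpret real_distribution \<mu> by fact
  have "integrable \<mu> (\<lambda>x. (cmod (f x))\<^sup>2)"
    by (rule integrable_const_bound[where B="C\<^sup>2"]) (use assms(2,3) in \<open>auto intro!: power_mono\<close>)
  then show ?thesis using assms(2) by (simp add: square_integrable_def)
qed

lemma square_integrable_wave:
  assumes "real_distribution \<mu>" shows "square_integrable \<mu> (wave \<xi>)"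
  using assms by (rule square_integrable_bounded[where C=1]) auto

lemma square_integrable_add:
  assumes "square_integrable \<mu> f" "square_integrable \<mu> g"
  shows "square_integrable \<mu> (\<lambda>x. f x + g x)"
proof -
  have "(cmod (a + b))\<^sup>2 \<le> 2 * (cmod a)\<^sup>2 + 2 * (cmod b)\<^sup>2" for a b
    using power_mono[OF norm_triangle_ineq[of a b], of 2] sum_squares_bound[of "cmod a" "cmod b"]
    by (simp add: power2_sum)
  moreover have "integrable \<mu> (\<lambda>x. 2 * (cmod (f x))\<^sup>2 + 2 * (cmod (g x))\<^sup>2)"
    using assms by (auto simp: square_integrable_def)
  ultimately have "integrable \<mu> (\<lambda>x. (cmod (f x + g x))\<^sup>2)"
    using assms by (elim Bochner_Integration.integrable_bound) (auto simp: square_integrable_def)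
  then show ?thesis using assms by (auto simp: square_integrable_def)
qed

lemma square_integrable_cmult:
  assumes "square_integrable \<mu> f"
  shows "square_integrable \<mu> (\<lambda>x. c * f x)"
  using assms by (auto simp: square_integrable_def norm_mult power_mult_distrib)

lemma square_integrable_diff:
  assumes "square_integrable \<mu> f" "square_integrable \<mu> g"
  shows "square_integrable \<mu> (\<lambda>x. f x - g x)"
  using square_integrable_add[OF assms(1) square_integrable_cmult[OF assms(2), of "-1"]] by simp

lemma square_integrable_sum:
  assumes "finite F" "\<And>i. i \<in> F \<Longrightarrow> square_integrable \<mu> (e i)"
  shows "square_integrable \<mu> (\<lambda>x. \<Sum>i\<in>F. c i * e i x)"
  using assms
  by (induction F rule: finite_induct)
     (auto simp: square_integrable_def[of _ "\<lambda>_. 0"] intro!: square_integrable_add square_integrable_cmult)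

lemma integrable_mult_cnj:
  assumes "square_integrable \<mu> f" "square_integrable \<mu> g"
  shows "integrable \<mu> (\<lambda>x. f x * cnj (g x))"
proof -
  have le: "cmod (a * cnj b) \<le> (cmod a)\<^sup>2 + (cmod b)\<^sup>2" for a b
    using sum_squares_bound[of "cmod a" "cmod b"] zero_le_power2[of "cmod a"] zero_le_power2[of "cmod b"]
    unfolding norm_mult complex_mod_cnj by linarith
  have int: "integrable \<mu> (\<lambda>x. (cmod (f x))\<^sup>2 + (cmod (g x))\<^sup>2)"
    using assms by (auto simp: square_integrable_def)
  have [measurable]: "f \<in> borel_measurable \<mu>" "g \<in> borel_measurable \<mu>"
    using assms by (auto simp: square_integrable_def)
  have [measurable]: "(\<lambda>x. cnj (g x)) \<in> borel_measurable \<mu>"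
    by (rule measurable_compose[OF \<open>g \<in> _\<close> borel_measurable_continuous_onI]) (intro continuous_intros)
  show ?thesis
    by (rule Bochner_Integration.integrable_bound[OF int]) (use le in auto)
qed

text \<open>Squared form of the triangle inequality, which keeps the argument free of square roots;
  its factor 2 is the origin of the bounds \<epsilon> / 4 below.\<close>

lemma L2_norm_add_le:
  assumes "square_integrable \<mu> f" "square_integrable \<mu> g"
  shows "(\<integral>x. (cmod (f x + g x))\<^sup>2 \<partial>\<mu>) \<le> 2 * (\<integral>x. (cmod (f x))\<^sup>2 \<partial>\<mu>) + 2 * (\<integral>x. (cmod (g x))\<^sup>2 \<partial>\<mu>)"
proof -
  have "(cmod (a + b))\<^sup>2 \<le> 2 * (cmod a)\<^sup>2 + 2 * (cmod b)\<^sup>2" for a b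
    using power_mono[OF norm_triangle_ineq[of a b], of 2] sum_squares_bound[of "cmod a" "cmod b"]
    by (simp add: power2_sum)
  then have "(\<integral>x. (cmod (f x + g x))\<^sup>2 \<partial>\<mu>) \<le> (\<integral>x. 2 * (cmod (f x))\<^sup>2 + 2 * (cmod (g x))\<^sup>2 \<partial>\<mu>)"
    using assms square_integrable_add[OF assms]
    by (intro integral_mono) (auto simp: square_integrable_def)
  then show ?thesis using assms by (simp add: square_integrable_def)
qed

text \<open>Completing the square in the coefficient \<open>c\<close>: its optimal value is
  \<open>L2_inner \<mu> f e\<close>, and any other choice costs the squared deviation.\<close>

lemma L2_norm_diff_cmult:
  assumes "square_integrable \<mu> f" "square_integrable \<mu> e" "L2_inner \<mu> e e = 1"
  shows "(\<integral>x. (cmod (f x - c * e x))\<^sup>2 \<partial>\<mu>) =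
    (\<integral>x. (cmod (f x))\<^sup>2 \<partial>\<mu>) - (cmod (L2_inner \<mu> f e))\<^sup>2 + (cmod (c - L2_inner \<mu> f e))\<^sup>2"
proof -
  have eq: "(cmod (a - c * b))\<^sup>2 = (cmod a)\<^sup>2 - 2 * Re (cnj c * (a * cnj b)) + (cmod c)\<^sup>2 * Re (b * cnj b)"
    for a b :: complex
    unfolding cmod_power2 by (simp add: algebra_simps power2_eq_square)
  note I = integrable_mult_cnj[OF assms(1,2)] integrable_mult_cnj[OF assms(2,2)]
  have "(\<integral>x. (cmod (f x - c * e x))\<^sup>2 \<partial>\<mu>) =
     (\<integral>x. (cmod (f x))\<^sup>2 \<partial>\<mu>) - 2 * Re (\<integral>x. cnj c * (f x * cnj (e x)) \<partial>\<mu>)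
       + (cmod c)\<^sup>2 * Re (\<integral>x. e x * cnj (e x) \<partial>\<mu>)"
  proof -
    have 1: "integrable \<mu> (\<lambda>x. Re (cnj c * (f x * cnj (e x))))" "integrable \<mu> (\<lambda>x. Re (e x * cnj (e x)))"
      "integrable \<mu> (\<lambda>x. (cmod (f x))\<^sup>2)"
      using I assms(1) by (simp_all only: square_integrable_def integrable_Re integrable_mult_right)
    then have "(\<integral>x. (cmod (f x - c * e x))\<^sup>2 \<partial>\<mu>) = (\<integral>x. (cmod (f x))\<^sup>2 \<partial>\<mu>)
        - 2 * (\<integral>x. Re (cnj c * (f x * cnj (e x))) \<partial>\<mu>) + (cmod c)\<^sup>2 * (\<integral>x. Re (e x * cnj (e x)) \<partial>\<mu>)"
      unfolding eq
      by (simp only: Bochner_Integration.integral_add Bochner_Integration.integral_diff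
        Bochner_Integration.integrable_diff integrable_mult_right integral_mult_right_zero)
    moreover have "(\<integral>x. Re (cnj c * (f x * cnj (e x))) \<partial>\<mu>) = Re (\<integral>x. cnj c * (f x * cnj (e x)) \<partial>\<mu>)"
      using I by (intro integral_Re integrable_mult_right) auto
    moreover have "(\<integral>x. Re (e x * cnj (e x)) \<partial>\<mu>) = Re (\<integral>x. e x * cnj (e x) \<partial>\<mu>)"
      using I by (intro integral_Re) auto
    ultimately show ?thesis by simp
  qed
  also have "\<dots> = (\<integral>x. (cmod (f x))\<^sup>2 \<partial>\<mu>) - 2 * Re (cnj c * L2_inner \<mu> f e)
       + (cmod c)\<^sup>2 * Re (L2_inner \<mu> e e)"
    unfolding L2_inner_def by (simp only: integral_mult_right_zero)
  also have "\<dots> = (\<integral>x. (cmod (f x))\<^sup>2 \<partial>\<mu>) - (cmod (L2_inner \<mu> f e))\<^sup>2 + (cmod (c - L2_inner \<mu> f e))\<^sup>2"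
    unfolding assms(3) cmod_power2 by (simp add: algebra_simps power2_eq_square)
  finally show ?thesis .
qed

text \<open>One term is removed at a time; \<open>f\<close> is generalized because the induction
  hypothesis is applied to \<open>h\<close>, whose coefficients against the remaining functions are
  those of \<open>f\<close>. Keeping \<open>c\<close> arbitrary yields both Bessel's inequality and
  a lower bound on the error of every linear combination.\<close>

lemma L2_norm_diff_orthonormal:
  assumes "finite F" "square_integrable \<mu> f" "\<And>i. i \<in> F \<Longrightarrow> square_integrable \<mu> (e i)"
    and "\<And>i j. i \<in> F \<Longrightarrow> j \<in> F \<Longrightarrow> L2_inner \<mu> (e i) (e j) = (if i = j then 1 else 0)"
  shows "(\<integral>x. (cmod (f x - (\<Sum>i\<in>F. c i * e i x)))\<^sup>2 \<partial>\<mu>) =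
    (\<integral>x. (cmod (f x))\<^sup>2 \<partial>\<mu>) - (\<Sum>i\<in>F. (cmod (L2_inner \<mu> f (e i)))\<^sup>2)
      + (\<Sum>i\<in>F. (cmod (c i - L2_inner \<mu> f (e i)))\<^sup>2)"
  using assms
proof (induction F arbitrary: f rule: finite_induct)
  case empty
  then show ?case by simp
next
  case (insert i F)
  define h where "h x = f x - c i * e i x" for x
  have h: "square_integrable \<mu> h"
    unfolding h_def using insert.prems by (intro square_integrable_diff square_integrable_cmult) auto
  have inner: "L2_inner \<mu> h (e j) = L2_inner \<mu> f (e j)" if "j \<in> F" for j
  proof -
    have "L2_inner \<mu> (e i) (e j) = 0" using insert.prems(3) insert.hyps that by auto
    moreover have "integrable \<mu> (\<lambda>x. f x * cnj (e j x))" "integrable \<mu> (\<lambda>x. e i x * cnj (e j x))"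
      using insert.prems(1,2) that by (auto intro!: integrable_mult_cnj)
    ultimately show ?thesis
      unfolding L2_inner_def h_def by (simp add: left_diff_distrib mult.assoc)
  qed
  have eq: "(\<lambda>x. f x - (\<Sum>i\<in>insert i F. c i * e i x)) = (\<lambda>x. h x - (\<Sum>i\<in>F. c i * e i x))"
    using insert.hyps by (simp add: h_def fun_eq_iff)
  have eq2: "(\<integral>x. (cmod (h x - (\<Sum>i\<in>F. c i * e i x)))\<^sup>2 \<partial>\<mu>) =
    (\<integral>x. (cmod (h x))\<^sup>2 \<partial>\<mu>) - (\<Sum>i\<in>F. (cmod (L2_inner \<mu> f (e i)))\<^sup>2)
      + (\<Sum>i\<in>F. (cmod (c i - L2_inner \<mu> f (e i)))\<^sup>2)"
    using insert.IH[OF h] insert.prems by (simp add: inner)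
  have eq3: "(\<integral>x. (cmod (h x))\<^sup>2 \<partial>\<mu>) = (\<integral>x. (cmod (f x))\<^sup>2 \<partial>\<mu>)
      - (cmod (L2_inner \<mu> f (e i)))\<^sup>2 + (cmod (c i - L2_inner \<mu> f (e i)))\<^sup>2"
    unfolding h_def by (rule L2_norm_diff_cmult) (use insert.prems in auto)
  have "(\<integral>x. (cmod (f x - (\<Sum>i\<in>insert i F. c i * e i x)))\<^sup>2 \<partial>\<mu>) =
      (\<integral>x. (cmod (h x - (\<Sum>i\<in>F. c i * e i x)))\<^sup>2 \<partial>\<mu>)"
    using arg_cong[OF eq, of "\<lambda>g. \<integral>x. (cmod (g x))\<^sup>2 \<partial>\<mu>"] .
  then show ?case
    unfolding eq2 eq3 sum.insert[OF insert.hyps] by linarith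
qed

lemma Bessel_inequality:
  assumes "finite F" "square_integrable \<mu> f" "\<And>i. i \<in> F \<Longrightarrow> square_integrable \<mu> (e i)"
    and "\<And>i j. i \<in> F \<Longrightarrow> j \<in> F \<Longrightarrow> L2_inner \<mu> (e i) (e j) = (if i = j then 1 else 0)"
  shows "(\<Sum>i\<in>F. (cmod (L2_inner \<mu> f (e i)))\<^sup>2) \<le> (\<integral>x. (cmod (f x))\<^sup>2 \<partial>\<mu>)"
proof -
  have "0 \<le> (\<integral>x. (cmod (f x - (\<Sum>i\<in>F. L2_inner \<mu> f (e i) * e i x)))\<^sup>2 \<partial>\<mu>)" by simp
  with L2_norm_diff_orthonormal[of F \<mu> f e "\<lambda>i. L2_inner \<mu> f (e i)"] assms show ?thesis by simp
qed

text \<open>The completeness clause of \<open>L2_orthonormal_basis\<close> for a single function: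
  membership in the closed linear span. Isolating it lets the class of such functions be enlarged
  step by step.\<close>

definition approximable ::
    "real measure \<Rightarrow> 'i set \<Rightarrow> ('i \<Rightarrow> real \<Rightarrow> complex) \<Rightarrow> (real \<Rightarrow> complex) \<Rightarrow> bool" where
  "approximable \<mu> I e f \<longleftrightarrow> (\<forall>\<epsilon>>0. \<exists>F c. finite F \<and> F \<subseteq> I \<and>
     (\<integral>x. (cmod (f x - (\<Sum>i\<in>F. c i * e i x)))\<^sup>2 \<partial>\<mu>) < \<epsilon>)"

locale L2_family =
  fixes \<mu> :: "real measure" and I :: "'i set" and e :: "'i \<Rightarrow> real \<Rightarrow> complex"
  assumes distribution: "real_distribution \<mu>"
    and square_integrable_family: "\<And>i. i \<in> I \<Longrightarrow> square_integrable \<mu> (e i)"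
begin

sublocale real_distribution \<mu> by (fact distribution)

lemma approximable_add:
  assumes "approximable \<mu> I e f" "approximable \<mu> I e g" "square_integrable \<mu> f" "square_integrable \<mu> g"
  shows "approximable \<mu> I e (\<lambda>x. f x + g x)"
  unfolding approximable_def
proof (intro allI impI)
  fix \<epsilon> :: real assume "\<epsilon> > 0"
  then have "\<epsilon> / 4 > 0" by simp
  then obtain F c G d where F: "finite F" "F \<subseteq> I" "finite G" "G \<subseteq> I"
    and lt: "(\<integral>x. (cmod (f x - (\<Sum>i\<in>F. c i * e i x)))\<^sup>2 \<partial>\<mu>) < \<epsilon> / 4"
      "(\<integral>x. (cmod (g x - (\<Sum>i\<in>G. d i * e i x)))\<^sup>2 \<partial>\<mu>) < \<epsilon> / 4"
    using assms(1,2) unfolding approximable_def by meson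
  define b where "b i = (if i \<in> F then c i else 0) + (if i \<in> G then d i else 0)" for i
  have "(\<Sum>i\<in>F. c i * e i x) = (\<Sum>i\<in>F \<union> G. (if i \<in> F then c i else 0) * e i x)"
    "(\<Sum>i\<in>G. d i * e i x) = (\<Sum>i\<in>F \<union> G. (if i \<in> G then d i else 0) * e i x)" for x
    using F by (auto intro!: sum.mono_neutral_cong_left)
  then have eq: "f x + g x - (\<Sum>i\<in>F \<union> G. b i * e i x) =
     (f x - (\<Sum>i\<in>F. c i * e i x)) + (g x - (\<Sum>i\<in>G. d i * e i x))" for x
    by (simp add: b_def distrib_right sum.distrib)
  have "(\<integral>x. (cmod (f x + g x - (\<Sum>i\<in>F \<union> G. b i * e i x)))\<^sup>2 \<partial>\<mu>) \<le>
    2 * (\<integral>x. (cmod (f x - (\<Sum>i\<in>F. c i * e i x)))\<^sup>2 \<partial>\<mu>) +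
    2 * (\<integral>x. (cmod (g x - (\<Sum>i\<in>G. d i * e i x)))\<^sup>2 \<partial>\<mu>)"
    unfolding eq by (rule L2_norm_add_le)
      (use F assms square_integrable_family in \<open>auto intro!: square_integrable_diff square_integrable_sum\<close>)
  with lt have "(\<integral>x. (cmod (f x + g x - (\<Sum>i\<in>F \<union> G. b i * e i x)))\<^sup>2 \<partial>\<mu>) < \<epsilon>" by simp
  with F show "\<exists>F c. finite F \<and> F \<subseteq> I \<and> (\<integral>x. (cmod (f x + g x - (\<Sum>i\<in>F. c i * e i x)))\<^sup>2 \<partial>\<mu>) < \<epsilon>"
    by (intro exI[of _ "F \<union> G"] exI[of _ b]) auto
qed

lemma approximable_cmult:
  assumes "approximable \<mu> I e f"
  shows "approximable \<mu> I e (\<lambda>x. a * f x)"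
  unfolding approximable_def
proof (intro allI impI)
  fix \<epsilon> :: real assume "\<epsilon> > 0"
  \<comment> \<open>The summand 1 keeps the tolerance positive when \<open>a = 0\<close>.\<close>
  have pos: "(cmod a)\<^sup>2 + 1 > 0" by (simp add: add_nonneg_pos)
  with \<open>\<epsilon> > 0\<close> have "\<epsilon> / ((cmod a)\<^sup>2 + 1) > 0" by simp
  then obtain F c where F: "finite F" "F \<subseteq> I"
    and lt: "(\<integral>x. (cmod (f x - (\<Sum>i\<in>F. c i * e i x)))\<^sup>2 \<partial>\<mu>) < \<epsilon> / ((cmod a)\<^sup>2 + 1)" (is "?J < _")
    using assms unfolding approximable_def by meson
  have "a * f x - (\<Sum>i\<in>F. (a * c i) * e i x) = a * (f x - (\<Sum>i\<in>F. c i * e i x))" for x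
    by (simp add: right_diff_distrib sum_distrib_left mult.assoc)
  then have "(\<integral>x. (cmod (a * f x - (\<Sum>i\<in>F. (a * c i) * e i x)))\<^sup>2 \<partial>\<mu>) = (cmod a)\<^sup>2 * ?J"
    by (simp add: norm_mult power_mult_distrib)
  also have "\<dots> \<le> ((cmod a)\<^sup>2 + 1) * ?J" by (intro mult_right_mono) auto
  also have "\<dots> < \<epsilon>" using iffD1[OF pos_less_divide_eq[OF pos] lt] by (subst mult.commute)
  finally show "\<exists>F c. finite F \<and> F \<subseteq> I \<and> (\<integral>x. (cmod (a * f x - (\<Sum>i\<in>F. c i * e i x)))\<^sup>2 \<partial>\<mu>) < \<epsilon>"
    using F by (intro exI[of _ F] exI[of _ "\<lambda>i. a * c i"] conjI)
qed

lemma approximable_zero: "approximable \<mu> I e (\<lambda>_. 0)"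
  unfolding approximable_def by (auto intro!: exI[of _ "{}"])

lemma approximable_sum:
  assumes "finite F" "\<And>i. i \<in> F \<Longrightarrow> approximable \<mu> I e (g i)" "\<And>i. i \<in> F \<Longrightarrow> square_integrable \<mu> (g i)"
  shows "approximable \<mu> I e (\<lambda>x. \<Sum>i\<in>F. c i * g i x)"
  using assms
proof (induction F rule: finite_induct)
  case empty
  show ?case by (simp add: approximable_zero)
next
  case (insert i F)
  then show ?case
    by (auto intro!: approximable_add approximable_cmult square_integrable_cmult square_integrable_sum)
qed

lemma approximable_closed:
  assumes f: "square_integrable \<mu> f"
    and near: "\<And>\<epsilon>. \<epsilon> > 0 \<Longrightarrow> \<exists>g. approximable \<mu> I e g \<and> square_integrable \<mu> g \<and> (\<integral>x. (cmod (f x - g x))\<^sup>2 \<partial>\<mu>) < \<epsilon>"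
  shows "approximable \<mu> I e f"
  unfolding approximable_def
proof (intro allI impI)
  fix \<epsilon> :: real assume "\<epsilon> > 0"
  then have \<epsilon>: "\<epsilon> / 4 > 0" by simp
  obtain g where g: "approximable \<mu> I e g" "square_integrable \<mu> g" "(\<integral>x. (cmod (f x - g x))\<^sup>2 \<partial>\<mu>) < \<epsilon> / 4"
    using near[OF \<epsilon>] by blast
  obtain F c where F: "finite F" "F \<subseteq> I" "(\<integral>x. (cmod (g x - (\<Sum>i\<in>F. c i * e i x)))\<^sup>2 \<partial>\<mu>) < \<epsilon> / 4"
    using g(1) \<epsilon> unfolding approximable_def by meson
  have "(\<integral>x. (cmod ((f x - g x) + (g x - (\<Sum>i\<in>F. c i * e i x))))\<^sup>2 \<partial>\<mu>) \<le>
    2 * (\<integral>x. (cmod (f x - g x))\<^sup>2 \<partial>\<mu>) + 2 * (\<integral>x. (cmod (g x - (\<Sum>i\<in>F. c i * e i x)))\<^sup>2 \<partial>\<mu>)"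
    by (rule L2_norm_add_le)
      (use F g f square_integrable_family in \<open>auto intro!: square_integrable_diff square_integrable_sum\<close>)
  with g(3) F(3) have "(\<integral>x. (cmod (f x - (\<Sum>i\<in>F. c i * e i x)))\<^sup>2 \<partial>\<mu>) < \<epsilon>" by simp
  with F show "\<exists>F c. finite F \<and> F \<subseteq> I \<and> (\<integral>x. (cmod (f x - (\<Sum>i\<in>F. c i * e i x)))\<^sup>2 \<partial>\<mu>) < \<epsilon>" by (intro exI[of _ F] exI[of _ c] conjI)
qed

text \<open>Pointwise convergence under a square-integrable majorant is convergence in L2: the limit
  inherits the bound \<open>w\<close>, so the squared errors are dominated by four times the square
  of \<open>w\<close>.\<close>

lemma approximable_dominated_limit:
  assumes f: "f \<in> borel_measurable borel"
    and g: "\<And>n. approximable \<mu> I e (g n)" "\<And>n. g n \<in> borel_measurable borel"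
    and lim: "\<And>x. (\<lambda>n. g n x) \<longlonglongrightarrow> f x"
    and w: "integrable \<mu> (\<lambda>x. (w x)\<^sup>2)" "\<And>n x. cmod (g n x) \<le> w x"
  shows "approximable \<mu> I e f"
proof (rule approximable_closed)
  have bd: "cmod (f x) \<le> w x" for x
    by (rule LIMSEQ_le_const2[OF tendsto_norm[OF lim]]) (use w(2) in auto)
  have sq: "(cmod a)\<^sup>2 \<le> (w x)\<^sup>2" if "cmod a \<le> w x" for a x
    using that by (auto intro!: power_mono)
  show sf: "square_integrable \<mu> f"
    unfolding square_integrable_def using f w(1) bd sq
    by (auto intro!: Bochner_Integration.integrable_bound[OF w(1)])
  have sg: "square_integrable \<mu> (g n)" for n
    unfolding square_integrable_def using g(2) w sq
    by (auto intro!: Bochner_Integration.integrable_bound[OF w(1)])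
  have "(\<lambda>n. \<integral>x. (cmod (f x - g n x))\<^sup>2 \<partial>\<mu>) \<longlonglongrightarrow> (\<integral>x. 0 \<partial>\<mu>)"
  proof (rule integral_dominated_convergence[where w="\<lambda>x. 4 * (w x)\<^sup>2"])
    show "AE x in \<mu>. (\<lambda>n. (cmod (f x - g n x))\<^sup>2) \<longlonglongrightarrow> 0"
    proof (intro AE_I2)
      fix x
      have "(\<lambda>n. (cmod (f x - g n x))\<^sup>2) \<longlonglongrightarrow> (cmod (f x - f x))\<^sup>2"
        by (intro tendsto_intros lim)
      then show "(\<lambda>n. (cmod (f x - g n x))\<^sup>2) \<longlonglongrightarrow> 0" by simp
    qed
    fix n
    have "(cmod (f x - g n x))\<^sup>2 \<le> 4 * (w x)\<^sup>2" for x
    proof -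
      have "cmod (f x - g n x) \<le> 2 * w x"
        using norm_triangle_ineq4[of "f x" "g n x"] bd[of x] w(2)[of n x] by linarith
      then show ?thesis using power_mono[of "cmod (f x - g n x)" "2 * w x" 2] by (simp add: power_mult_distrib)
    qed
    then show "AE x in \<mu>. norm ((cmod (f x - g n x))\<^sup>2) \<le> 4 * (w x)\<^sup>2" by simp
  qed (use f g w in auto)
  then have *: "(\<lambda>n. \<integral>x. (cmod (f x - g n x))\<^sup>2 \<partial>\<mu>) \<longlonglongrightarrow> 0" by simp
  fix \<epsilon> :: real assume "\<epsilon> > 0"
  then have "\<forall>\<^sub>F n in sequentially. (\<integral>x. (cmod (f x - g n x))\<^sup>2 \<partial>\<mu>) < \<epsilon>"
    using order_tendstoD(2)[OF *] by blast
  then obtain n where "(\<integral>x. (cmod (f x - g n x))\<^sup>2 \<partial>\<mu>) < \<epsilon>"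
    by (auto simp: eventually_sequentially)
  with g sg show "\<exists>g. approximable \<mu> I e g \<and> square_integrable \<mu> g \<and> (\<integral>x. (cmod (f x - g x))\<^sup>2 \<partial>\<mu>) < \<epsilon>"
    by blast
qed

lemma approximable_bounded_limit:
  assumes "f \<in> borel_measurable borel"
    and "\<And>n. approximable \<mu> I e (g n)" "\<And>n. g n \<in> borel_measurable borel"
    and "\<And>x. (\<lambda>n. g n x) \<longlonglongrightarrow> f x" "\<And>n x. cmod (g n x) \<le> C"
  shows "approximable \<mu> I e f"
  by (rule approximable_dominated_limit[where g=g and w="\<lambda>_. C"]) (use assms in auto)

end

section \<open>Totality of the exponentials\<close>

text \<open>Once the exponentials lie in the closed span, so does every square-integrable function,
  for any probability measure on the line. Uniform polynomial approximation needs a compact set,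
  which is found not on the line but in [-1, 1], the range of a cosine; letting the period of the
  cosine grow then recovers intervals.\<close>

locale L2_wave_family = L2_family +
  assumes approximable_wave: "\<And>\<xi>. approximable \<mu> I e (wave \<xi>)"
begin

lemma square_integrable_bdd:
  assumes "f \<in> borel_measurable borel" "\<And>x. cmod (f x) \<le> C"
  shows "square_integrable \<mu> f"
  using distribution assms by (rule square_integrable_bounded)

text \<open>A cosine is a combination of two exponentials, so multiplying by it shifts the frequency
  by \<open>s\<close> and \<open>- s\<close>; this is why \<xi> is arbitrary in the induction. The
  phase \<open>c\<close> only enters the coefficients.\<close>

lemma approximable_wave_cos_power:
  "approximable \<mu> I e (\<lambda>x. wave \<xi> x * of_real (cos (t * (x - c)) ^ k))"
proof (induction k arbitrary: \<xi>)
  case 0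
  show ?case using approximable_wave[of \<xi>] by simp
next
  case (Suc k)
  \<comment> \<open>\<open>wave\<close> has the factor 2 pi in its exponent, the cosine does
    not.\<close>
  define s where "s = t / (2 * pi)"
  have cos: "complex_of_real (cos (t * (x - c))) =
      exp (- (\<i> * of_real (t * c))) / 2 * wave s x + exp (\<i> * of_real (t * c)) / 2 * wave (- s) x" for x
    by (simp add: wave_def cos_of_real[symmetric] cos_exp_eq s_def exp_add[symmetric] algebra_simps diff_divide_distrib
      add_divide_distrib del: cos_of_real)
  have "approximable \<mu> I e (\<lambda>x. exp (- (\<i> * of_real (t * c))) / 2 * (wave (\<xi> + s) x * of_real (cos (t * (x - c)) ^ k))
     + exp (\<i> * of_real (t * c)) / 2 * (wave (\<xi> - s) x * of_real (cos (t * (x - c)) ^ k)))"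
    by (intro approximable_add approximable_cmult Suc.IH square_integrable_cmult square_integrable_bdd[where C=1])
       (auto simp: norm_mult norm_power power_le_one)
  moreover have "wave \<xi> x * of_real (cos (t * (x - c)) ^ Suc k) =
    exp (- (\<i> * of_real (t * c))) / 2 * (wave (\<xi> + s) x * of_real (cos (t * (x - c)) ^ k))
     + exp (\<i> * of_real (t * c)) / 2 * (wave (\<xi> - s) x * of_real (cos (t * (x - c)) ^ k))" for x
  proof -
    have "wave (\<xi> + s) x = wave \<xi> x * wave s x" "wave (\<xi> - s) x = wave \<xi> x * wave (- s) x"
      using wave_add[of \<xi> s x] wave_add[of \<xi> "- s" x] by simp_all
    moreover have "wave \<xi> x * of_real (cos (t * (x - c)) ^ Suc k) =
      wave \<xi> x * (of_real (cos (t * (x - c))) * of_real (cos (t * (x - c)) ^ k))" by simp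
    moreover have "w * ((\<alpha> * u + \<beta> * v) * z) = \<alpha> * (w * u * z) + \<beta> * (w * v * z)" for w u v z \<alpha> \<beta> :: complex
      by (simp add: algebra_simps)
    ultimately show ?thesis using cos[of x] by (simp only:)
  qed
  ultimately show ?case by simp
qed

text \<open>Weierstrass approximation of \<phi> on [-1, 1]. A uniform error below
  \<open>sqrt (\<epsilon> / 2)\<close> suffices because \<mu> has total mass 1.\<close>

lemma approximable_continuous_cos:
  fixes \<phi> :: "real \<Rightarrow> real"
  assumes \<phi>: "continuous_on UNIV \<phi>"
  shows "approximable \<mu> I e (\<lambda>x. of_real (\<phi> (cos (t * (x - c)))))"
proof (rule approximable_closed)
  have [measurable]: "\<phi> \<in> borel_measurable borel"
    using \<phi> by (rule borel_measurable_continuous_onI)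
  obtain C where "\<And>x. x \<in> {-1..1} \<Longrightarrow> \<bar>\<phi> x\<bar> \<le> C"
    using compact_imp_bounded[OF compact_continuous_image[OF continuous_on_subset[OF \<phi>] compact_Icc]]
    by (fastforce simp: bounded_iff)
  then show sq: "square_integrable \<mu> (\<lambda>x. of_real (\<phi> (cos (t * (x - c)))))"
    by (intro square_integrable_bdd[where C=C]) auto
  fix \<epsilon> :: real assume "\<epsilon> > 0"
  then have "sqrt (\<epsilon> / 2) > 0" by simp
  then obtain g where g: "real_polynomial_function g" "\<And>x. x \<in> {-1..1} \<Longrightarrow> \<bar>\<phi> x - g x\<bar> < sqrt (\<epsilon> / 2)"
    using Stone_Weierstrass_real_polynomial_function[OF compact_Icc continuous_on_subset[OF \<phi>], of "-1" 1] by blast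
  obtain a n where a: "g = (\<lambda>x. \<Sum>i\<le>n. a i * x ^ i)"
    using g(1) unfolding real_polynomial_function_iff_sum by blast
  let ?g = "\<lambda>x. complex_of_real (g (cos (t * (x - c))))"
  have bdd: "square_integrable \<mu> (\<lambda>x. of_real (cos (t * (x - c)) ^ i))" for i
    by (rule square_integrable_bdd[where C=1]) (auto simp: norm_power power_le_one)
  have appr: "approximable \<mu> I e (\<lambda>x. of_real (cos (t * (x - c)) ^ i))" for i
    using approximable_wave_cos_power[of 0 t c i] by simp
  have eq: "?g = (\<lambda>x. \<Sum>i\<le>n. of_real (a i) * of_real (cos (t * (x - c)) ^ i))"
    by (simp add: a)
  have "approximable \<mu> I e ?g" unfolding eq by (intro approximable_sum bdd appr) auto
  moreover have sg: "square_integrable \<mu> ?g" unfolding eq by (intro square_integrable_sum bdd) auto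
  moreover have "(\<integral>x. (cmod (of_real (\<phi> (cos (t * (x - c)))) - ?g x))\<^sup>2 \<partial>\<mu>) < \<epsilon>"
  proof -
    have "(\<integral>x. (cmod (of_real (\<phi> (cos (t * (x - c)))) - ?g x))\<^sup>2 \<partial>\<mu>) \<le> (\<integral>x. \<epsilon> / 2 \<partial>\<mu>)"
    proof (rule integral_mono)
      show "integrable \<mu> (\<lambda>x. (cmod (of_real (\<phi> (cos (t * (x - c)))) - ?g x))\<^sup>2)"
        using square_integrable_diff[OF sq sg] by (simp add: square_integrable_def)
      fix x
      have "\<bar>\<phi> (cos (t * (x - c))) - g (cos (t * (x - c)))\<bar>\<^sup>2 \<le> (sqrt (\<epsilon> / 2))\<^sup>2"
        using g(2)[of "cos (t * (x - c))"] by (intro power_mono) auto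
      then show "(cmod (of_real (\<phi> (cos (t * (x - c)))) - ?g x))\<^sup>2 \<le> \<epsilon> / 2"
        using \<open>\<epsilon> > 0\<close> unfolding of_real_diff[symmetric] norm_of_real by simp
    qed simp
    also have "\<dots> < \<epsilon>" using \<open>\<epsilon> > 0\<close> prob_space by simp
    finally show ?thesis .
  qed
  ultimately show "\<exists>g. approximable \<mu> I e g \<and> square_integrable \<mu> g \<and>
     (\<integral>x. (cmod (of_real (\<phi> (cos (t * (x - c)))) - g x))\<^sup>2 \<partial>\<mu>) < \<epsilon>" by blast
qed

text \<open>The continuous ramps \<open>?\<phi> n\<close> vanish up to \<open>d\<close> and increase
  to 1 beyond it.\<close>

lemma approximable_indicator_cos:
  "approximable \<mu> I e (\<lambda>x. indicator {x. cos (t * (x - c)) > d} x)"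
proof (rule approximable_bounded_limit)
  let ?\<phi> = "\<lambda>n u. min 1 (real n * max 0 (u - d))"
  show "approximable \<mu> I e (\<lambda>x. of_real (?\<phi> n (cos (t * (x - c)))))" for n
    by (rule approximable_continuous_cos) (intro continuous_intros)
  show "(\<lambda>n. complex_of_real (?\<phi> n (cos (t * (x - c))))) \<longlonglongrightarrow> indicator {x. cos (t * (x - c)) > d} x" for x
  proof (cases "cos (t * (x - c)) > d")
    case True
    then obtain m where m: "1 < real m * (cos (t * (x - c)) - d)"
      using reals_Archimedean3[of "cos (t * (x - c)) - d"] by auto
    have "?\<phi> n (cos (t * (x - c))) = 1" if "n \<ge> m" for n
    proof -
      have "real m * (cos (t * (x - c)) - d) \<le> real n * (cos (t * (x - c)) - d)"
        using that True by (intro mult_right_mono) auto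
      with m have "1 \<le> real n * (cos (t * (x - c)) - d)" by linarith
      with True show ?thesis by (simp add: max_def)
    qed
    then have "\<forall>\<^sub>F n in sequentially. complex_of_real (?\<phi> n (cos (t * (x - c)))) = indicator {x. cos (t * (x - c)) > d} x"
      using True by (intro eventually_sequentiallyI[of m]) simp
    then show ?thesis by (rule tendsto_eventually)
  next
    case False
    then show ?thesis by (simp add: max_def)
  qed
  show "cmod (of_real (?\<phi> n (cos (t * (x - c))))) \<le> 1" for n x
    using mult_nonneg_nonneg[of "real n" "max 0 (cos (t * (x - c)) - d)"] by (simp add: norm_of_real)
qed measurable

text \<open>For small \<open>t\<close> the set where cos (t (x - c)) exceeds cos (t r) is the
  interval of radius \<open>r\<close> about \<open>c\<close> together with its translates by
  multiples of 2 pi / t. With \<open>t = 1 / Suc n\<close> the translates move off to infinity, so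
  at every fixed point only the interval remains.\<close>

lemma approximable_indicator_Ioo: "approximable \<mu> I e (\<lambda>x. indicator {a<..<b} x)"
proof (cases "a < b")
  case False
  then show ?thesis by (simp add: approximable_zero)
next
  case True
  define c r where "c = (a + b) / 2" and "r = (b - a) / 2"
  have r: "r > 0" using True by (simp add: r_def)
  have ab: "{a<..<b} = {x. \<bar>x - c\<bar> < r}"
    by (auto simp: c_def r_def abs_less_iff field_simps)
  let ?A = "\<lambda>n. {x. cos (1 / Suc n * (x - c)) > cos (r / Suc n)}"
  show ?thesis
  proof (rule approximable_bounded_limit)
    show "approximable \<mu> I e (\<lambda>x. indicator (?A n) x)" for n
      by (rule approximable_indicator_cos)
    show "(\<lambda>n. indicator (?A n) x) \<longlonglongrightarrow> (indicator {a<..<b} x :: complex)" for x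
    proof -
      \<comment> \<open>Beyond \<open>m\<close> both \<open>r / Suc n\<close> and
        \<open>\<bar>x - c\<bar> / Suc n\<close> lie in [0, pi], where the cosine is strictly
        decreasing.\<close>
      obtain m :: nat where m: "real m > max r \<bar>x - c\<bar>" using reals_Archimedean2 by blast
      have "x \<in> ?A n \<longleftrightarrow> x \<in> {a<..<b}" if "n \<ge> m" for n
      proof -
        have "1 * real (Suc n) \<le> pi * Suc n" using pi_gt3 by (intro mult_right_mono) auto
        moreover have "r \<le> real (Suc n)" "\<bar>x - c\<bar> \<le> real (Suc n)" using that m by auto
        ultimately have "r \<le> pi * Suc n" "\<bar>x - c\<bar> \<le> pi * Suc n"
          unfolding mult_1 by (blast intro: order_trans)+
        then have "r / Suc n \<le> pi" "\<bar>x - c\<bar> / Suc n \<le> pi"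
          by (simp_all add: pos_divide_le_eq del: of_nat_Suc)
        then have "cos (r / Suc n) < cos (\<bar>x - c\<bar> / Suc n) \<longleftrightarrow> \<bar>x - c\<bar> / Suc n < r / Suc n"
          using r by (intro cos_mono_less_eq) auto
        moreover have "cos (\<bar>x - c\<bar> / Suc n) = cos (1 / Suc n * (x - c))"
          by (metis abs_divide abs_of_nat cos_abs_real mult_1 times_divide_eq_left)
        moreover have "\<bar>x - c\<bar> / Suc n < r / Suc n \<longleftrightarrow> \<bar>x - c\<bar> < r"
          by (simp add: divide_less_cancel)
        ultimately show ?thesis unfolding ab by simp
      qed
      then have "\<forall>\<^sub>F n in sequentially. indicator (?A n) x = (indicator {a<..<b} x :: complex)"
        by (intro eventually_sequentiallyI[of m]) (simp add: indicator_def)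
      then show ?thesis by (rule tendsto_eventually)
    qed
    show "cmod (indicator (?A n) x) \<le> 1" for n x by (simp add: indicator_def)
  qed measurable
qed

text \<open>Dynkin's argument: open intervals form an intersection-stable generator, complements
  need only the constant function 1, which is \<open>wave 0\<close>, and a disjoint union is the
  bounded limit of finite unions, whose indicators are sums.\<close>

lemma approximable_indicator:
  assumes "A \<in> sets borel"
  shows "approximable \<mu> I e (\<lambda>x. indicator A x)"
proof -
  let ?G = "range (\<lambda>(a, b). {a<..<b :: real})"
  have borel: "sets borel = sigma_sets UNIV ?G"
    using arg_cong[OF borel_eq_box[where 'a=real], of sets] by (simp add: box_real)
  have "Int_stable ?G"
  proof -
    have "{a<..<b} \<inter> {c<..<d} = {max a c<..<min b d}" for a b c d :: real by auto
    then show ?thesis by (fastforce simp: Int_stable_def)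
  qed
  moreover have "A \<in> sigma_sets UNIV ?G" using assms borel by simp
  ultimately show ?thesis
  proof (induction rule: sigma_sets_induct_disjoint[OF _ subset_UNIV[of ?G, folded Pow_UNIV], consumes 2, case_names basic empty compl union])
    case (basic A)
    then show ?case using approximable_indicator_Ioo by auto
  next
    case (compl A)
    have [measurable]: "A \<in> sets borel" using compl borel by simp
    have "approximable \<mu> I e (\<lambda>x. wave 0 x + (- 1) * indicator A x)"
      by (intro approximable_add approximable_cmult compl approximable_wave square_integrable_cmult square_integrable_bdd[where C=1])
         (auto simp: indicator_def)
    moreover have "wave 0 x + (- 1) * indicator A x = indicator (UNIV - A) x" for x
      by (simp add: indicator_def)
    ultimately show ?case by simp
  next
    case (union A)
    have [measurable]: "A i \<in> sets borel" for i using union borel by auto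
    show ?case
    proof (rule approximable_bounded_limit)
      have "(\<Sum>i<n. 1 * indicator (A i) x) = (indicator (\<Union>i<n. A i) x :: complex)" for n x
        using union(1) by (simp add: indicator_UN_disjoint disjoint_family_on_def)
      moreover have "approximable \<mu> I e (\<lambda>x. \<Sum>i<n. 1 * indicator (A i) x)" for n
        by (intro approximable_sum union square_integrable_bdd[where C=1]) (auto simp: indicator_def)
      ultimately show "approximable \<mu> I e (\<lambda>x. indicator (\<Union>i<n. A i) x)" for n by simp
      show "(\<lambda>n. indicator (\<Union>i<n. A i) x) \<longlonglongrightarrow> (indicator (\<Union>i. A i) x :: complex)" for x
        by (rule LIMSEQ_indicator_UN)
      show "cmod (indicator (\<Union>i<n. A i) x) \<le> 1" for n x by (simp add: indicator_def)
    qed measurable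
  qed (auto simp: approximable_zero)
qed

theorem approximable_square_integrable:
  assumes f: "square_integrable \<mu> f"
  shows "approximable \<mu> I e f"
proof -
  have [measurable]: "f \<in> borel_measurable borel" and int: "integrable \<mu> (\<lambda>x. (cmod (f x))\<^sup>2)"
    using f by (auto simp: square_integrable_def)
  \<comment> \<open>The reference point 0 turns the distance bound of this approximation theorem
    into the majorant \<open>2 * cmod (f x)\<close>.\<close>
  obtain F where F: "\<And>i. simple_function borel (F i)" "\<And>x. (\<lambda>i. F i x) \<longlonglongrightarrow> f x" "\<And>i x. cmod (F i x) \<le> 2 * cmod (f x)"
    using borel_measurable_implies_sequence_metric[of f borel 0] by auto
  show ?thesis
  proof (rule approximable_dominated_limit[where w="\<lambda>x. 2 * cmod (f x)"])
    fix i
    have fin: "finite (range (F i))"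
      using F(1)[of i] by (simp add: simple_function_def)
    have m: "F i -` {y} \<in> sets borel" for y
      using simple_functionD(2)[OF F(1), of i "{y}"] by simp
    have eq: "F i = (\<lambda>x. \<Sum>y\<in>range (F i). y * indicator (F i -` {y}) x)"
    proof
      fix x
      have "(\<Sum>y\<in>range (F i). y * indicator (F i -` {y}) x) = (\<Sum>y\<in>range (F i). if F i x = y then y else 0)"
        by (intro sum.cong) (auto simp: indicator_def)
      then show "F i x = (\<Sum>y\<in>range (F i). y * indicator (F i -` {y}) x)" using fin by simp
    qed
    have "approximable \<mu> I e (\<lambda>x. \<Sum>y\<in>range (F i). y * indicator (F i -` {y}) x)"
      using fin m by (intro approximable_sum approximable_indicator square_integrable_bdd[where C=1])
        (auto intro!: borel_measurable_indicator split: split_indicator)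
    then show "approximable \<mu> I e (F i)" by (subst eq)
    show "F i \<in> borel_measurable borel" using F(1) by (rule borel_measurable_simple_function)
  qed (use F int in \<open>auto simp: power_mult_distrib\<close>)
qed

end

section \<open>Fourier transforms of probability measures\<close>

lemma fourier_transform_eq_char: "fourier_transform M \<xi> = char M (- 2 * pi * \<xi>)"
  unfolding fourier_transform_def char_def by (simp add: mult_ac)

lemma continuous_fourier_transform:
  assumes "real_distribution M" shows "continuous_on UNIV (fourier_transform M)"
proof -
  have "continuous_on UNIV (char M)"
    using real_distribution.isCont_char[OF assms] by (auto intro: continuous_at_imp_continuous_on)
  then have "continuous_on UNIV (\<lambda>\<xi>. char M (- 2 * pi * \<xi>))"
    by (rule continuous_on_compose2) (auto intro!: continuous_intros)
  then show ?thesis by (simp add: fourier_transform_eq_char)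
qed

lemma fourier_transform_0: "real_distribution M \<Longrightarrow> fourier_transform M 0 = 1"
  by (simp add: fourier_transform_eq_char real_distribution.char_zero)

lemma fourier_transform_minus: "fourier_transform M (- \<xi>) = cnj (fourier_transform M \<xi>)"
proof -
  have "exp (- 2 * of_real pi * \<i> * of_real (- \<xi> * x)) = cnj (exp (- 2 * of_real pi * \<i> * of_real (\<xi> * x)))" for x
    by (simp add: exp_cnj)
  then show ?thesis unfolding fourier_transform_def by (simp only: Bochner_Integration.integral_cnj)
qed

lemma fourier_transform_eqD:
  assumes "real_distribution M" "real_distribution M'" "\<And>\<xi>. fourier_transform M \<xi> = fourier_transform M' \<xi>"
  shows "M = M'"
proof (rule Levy_uniqueness[OF assms(1,2)])
  show "char M = char M'"
  proof
    fix t show "char M t = char M' t"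
      using assms(3)[of "- t / (2 * pi)"] by (simp add: fourier_transform_eq_char)
  qed
qed

lemma real_distribution_convolution:
  assumes "real_distribution M" "real_distribution M'"
  shows "real_distribution (M \<star> M')"
proof -
  interpret M: real_distribution M by fact
  interpret M': real_distribution M' by fact
  interpret pair_prob_space M M' ..
  show ?thesis unfolding convolution_def by (rule P.real_distribution_distr) measurable
qed

lemma fourier_transform_convolution:
  assumes "real_distribution M" "real_distribution M'"
  shows "fourier_transform (M \<star> M') \<xi> = fourier_transform M \<xi> * fourier_transform M' \<xi>"
proof -
  interpret M: real_distribution M by fact
  interpret M': real_distribution M' by fact
  interpret pair_prob_space M M' ..
  let ?e = "\<lambda>x. exp (- 2 * of_real pi * \<i> * of_real (\<xi> * x))"
  have norm: "cmod (?e x) = 1" for x by (simp add: norm_exp_eq_Re)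
  have int: "integrable (M \<Otimes>\<^sub>M M') (\<lambda>(x, y). ?e x * ?e y)"
    by (rule P.integrable_const_bound[where B=1]) (auto simp: norm_mult norm)
  have "fourier_transform (M \<star> M') \<xi> = (\<integral>z. (case z of (x, y) \<Rightarrow> ?e x * ?e y) \<partial>(M \<Otimes>\<^sub>M M'))"
    unfolding fourier_transform_def convolution_def
    by (subst integral_distr) (auto simp: exp_add[symmetric] algebra_simps case_prod_unfold)
  also have "\<dots> = (\<integral>x. (\<integral>y. ?e x * ?e y \<partial>M') \<partial>M)"
    using integral_fst'[OF int] by simp
  also have "\<dots> = fourier_transform M \<xi> * fourier_transform M' \<xi>"
    unfolding fourier_transform_def by (simp only: integral_mult_right_zero integral_mult_left_zero)
  finally show ?thesis .
qed

lemma fourier_transform_distr_scale: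
  assumes "real_distribution M"
  shows "fourier_transform (distr M borel (\<lambda>x. c * x)) \<xi> = fourier_transform M (c * \<xi>)"
proof -
  interpret real_distribution M by fact
  show ?thesis unfolding fourier_transform_def by (subst integral_distr) (auto simp: mult_ac)
qed

lemma real_distribution_return: "real_distribution (return borel (x :: real))"
  by (simp add: real_distribution_def real_distribution_axioms_def prob_space_return)

lemma fourier_transform_return: "fourier_transform (return borel x) \<xi> = exp (- 2 * of_real pi * \<i> * of_real (\<xi> * x))"
  unfolding fourier_transform_def by (subst integral_return) auto

lemma real_distribution_discrete_uniform: "real_distribution (discrete_uniform A)"
  unfolding discrete_uniform_def by (rule prob_space.real_distribution_distr[OF prob_space_measure_pmf]) simp

lemma integral_discrete_uniform:
  fixes f :: "real \<Rightarrow> 'a :: {banach, second_countable_topology}"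
  assumes "finite A" "A \<noteq> {}" "f \<in> borel_measurable borel"
  shows "(\<integral>x. f x \<partial>discrete_uniform A) = (1 / card A) *\<^sub>R (\<Sum>a\<in>A. f a)"
proof -
  have "(\<integral>x. f x \<partial>discrete_uniform A) = (\<integral>x. f x \<partial>measure_pmf (pmf_of_set A))"
    unfolding discrete_uniform_def using assms(3) by (subst integral_distr) auto
  also have "\<dots> = (\<Sum>a\<in>A. pmf (pmf_of_set A) a *\<^sub>R f a)"
    using assms(1,2) by (intro integral_measure_pmf) auto
  also have "\<dots> = (1 / card A) *\<^sub>R (\<Sum>a\<in>A. f a)"
    using assms(1,2) by (simp add: scaleR_sum_right)
  finally show ?thesis .
qed

lemma fourier_transform_discrete_uniform:
  assumes "finite A" "A \<noteq> {}"
  shows "fourier_transform (discrete_uniform A) \<xi> = (\<Sum>a\<in>A. exp (- 2 * of_real pi * \<i> * of_real (\<xi> * a))) / card A"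
  unfolding fourier_transform_def using assms
  by (subst integral_discrete_uniform) (auto simp: scaleR_conv_of_real divide_inverse mult.commute)

lemma weakly_converges_fourier_transform:
  assumes "\<And>n. real_distribution (M n)" "real_distribution M'" "weakly_converges M M'"
  shows "(\<lambda>n. fourier_transform (M n) \<xi>) \<longlonglongrightarrow> fourier_transform M' \<xi>"
  unfolding fourier_transform_eq_char
  using assms by (intro levy_continuity1) (auto simp: weakly_converges_iff_weak_conv_m)

text \<open>If x + y lies in [-K, K] and x in [-r, r], then y lies in [-(K + r), K + r]. Read
  backwards, this bounds from below the mass that the second factor keeps near the origin.\<close>

lemma measure_convolution_le:
  assumes "real_distribution M" "real_distribution M'"
  shows "measure (M \<star> M') {-K..K} \<le> measure M' {-(K + r)..K + r} + measure M (- {-r..r})"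
proof -
  interpret M: real_distribution M by fact
  interpret M': real_distribution M' by fact
  interpret pair_prob_space M M' ..
  let ?A = "UNIV \<times> {-(K + r)..K + r}" and ?B = "(- {-r..r}) \<times> UNIV"
  have "measure (M \<star> M') {-K..K} = measure (M \<Otimes>\<^sub>M M') ((\<lambda>(x, y). x + y) -` {-K..K})"
    unfolding convolution_def by (subst measure_distr) (auto simp: space_pair_measure)
  also have "\<dots> \<le> measure (M \<Otimes>\<^sub>M M') (?A \<union> ?B)"
    by (rule P.finite_measure_mono) auto
  also have "\<dots> \<le> measure (M \<Otimes>\<^sub>M M') ?A + measure (M \<Otimes>\<^sub>M M') ?B"
    by (rule measure_Un_le) auto
  also have "measure (M \<Otimes>\<^sub>M M') ?A = measure M' {-(K + r)..K + r}"
    using M.prob_space M.emeasure_space_1 by (simp add: measure_def M'.emeasure_pair_measure_Times)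
  also have "measure (M \<Otimes>\<^sub>M M') ?B = measure M (- {-r..r})"
    using M'.emeasure_space_1 by (simp add: measure_def M'.emeasure_pair_measure_Times)
  finally show ?thesis .
qed

lemma (in real_distribution) ex_symmetric_interval:
  assumes "\<epsilon> > 0" shows "\<exists>K>0. measure M {-K..K} > 1 - \<epsilon>"
proof -
  have "(\<lambda>n. measure M {- real n..real n}) \<longlonglongrightarrow> measure M (\<Union>n. {- real n..real n})"
    by (intro finite_Lim_measure_incseq) (auto simp: incseq_def)
  moreover have "(\<Union>n. {- real n..real n}) = UNIV"
  proof -
    have "\<exists>n. x \<in> {- real n..real n}" for x
      using real_arch_simple[of "\<bar>x\<bar>"] by (auto simp: abs_le_iff minus_le_iff)
    then show ?thesis by blast
  qed
  ultimately have lim: "(\<lambda>n. measure M {- real n..real n}) \<longlonglongrightarrow> 1"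
    using prob_space by simp
  obtain n where n: "measure M {- real n..real n} > 1 - \<epsilon>"
    using eventually_happens'[OF _ order_tendstoD(1)[OF lim, of "1 - \<epsilon>"]] assms by auto
  \<comment> \<open>\<open>n\<close> could be 0, hence the passage to \<open>Suc n\<close> for a
    positive radius.\<close>
  have "measure M {- real n..real n} \<le> measure M {- real (Suc n)..real (Suc n)}"
    by (rule finite_measure_mono) auto
  with n have "measure M {- real (Suc n)..real (Suc n)} > 1 - \<epsilon>" by linarith
  then show ?thesis by (intro exI[of _ "real (Suc n)"]) simp
qed

text \<open>Each of the finitely many early measures has an interval of its own, and a maximum over
  these covers all of them at once.\<close>

lemma tight_eventuallyI:
  assumes M: "\<And>n. real_distribution (M n)"
    and ev: "\<And>\<epsilon>. \<epsilon> > 0 \<Longrightarrow> \<exists>K. \<forall>\<^sub>F n in sequentially. measure (M n) {-K..K} > 1 - \<epsilon>"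
  shows "tight M"
  unfolding tight_def
proof (intro conjI allI impI M)
  fix \<epsilon> :: real assume "\<epsilon> > 0"
  then obtain K m where K: "\<And>n. n \<ge> m \<Longrightarrow> measure (M n) {-K..K} > 1 - \<epsilon>"
    using ev unfolding eventually_sequentially by meson
  have "\<exists>k. measure (M n) {-k..k} > 1 - \<epsilon>" for n
    using real_distribution.ex_symmetric_interval[OF M \<open>\<epsilon> > 0\<close>, of n] by blast
  then obtain k where k: "\<And>n. measure (M n) {-k n..k n} > 1 - \<epsilon>" by metis
  define C where "C = Max (insert \<bar>K\<bar> ((\<lambda>n. \<bar>k n\<bar>) ` {..<m}))"
  have C: "\<bar>K\<bar> \<le> C" "\<And>n. n < m \<Longrightarrow> \<bar>k n\<bar> \<le> C"
    unfolding C_def by (auto intro!: Max_ge)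
  \<comment> \<open>\<open>tight\<close> asks for a half-open interval with distinct endpoints;
    enlarging \<open>C\<close> by 1 makes the closed interval fit.\<close>
  have "measure (M n) {-(C + 1)<..C + 1} > 1 - \<epsilon>" for n
  proof -
    interpret real_distribution "M n" by (rule M)
    obtain j where "\<bar>j\<bar> \<le> C" "measure (M n) {-j..j} > 1 - \<epsilon>"
      using C K[of n] k[of n] by (cases "n < m") (auto simp: not_less)
    moreover have "measure (M n) {-j..j} \<le> measure (M n) {-(C + 1)<..C + 1}"
      using \<open>\<bar>j\<bar> \<le> C\<close> by (intro finite_measure_mono) auto
    ultimately show ?thesis by linarith
  qed
  moreover have "-(C + 1) < C + 1" using C(1) by linarith
  ultimately show "\<exists>a b. a < b \<and> (\<forall>n. measure (M n) {a<..b} > 1 - \<epsilon>)" by blast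
qed

text \<open>Weak convergence tests continuous functions only, so the indicator of the interval is
  replaced by the trapezoid \<open>g\<close>, equal to 1 on [-K, K] and to 0 outside
  [-(K + 1), K + 1].\<close>

lemma weakly_converges_eventually_interval:
  assumes M: "\<And>n. real_distribution (M n)" "real_distribution M'" "weakly_converges M M'" and "\<epsilon> > 0"
  shows "\<exists>K. \<forall>\<^sub>F n in sequentially. measure (M n) {-K..K} > 1 - \<epsilon>"
proof -
  interpret M': real_distribution M' by fact
  obtain K where K: "K > 0" "measure M' {-K..K} > 1 - \<epsilon>"
    using M'.ex_symmetric_interval[OF \<open>\<epsilon> > 0\<close>] by blast
  define g where "g x = max 0 (min 1 (K + 1 - \<bar>x\<bar>))" for x :: real
  have cont: "continuous_on UNIV g" unfolding g_def by (intro continuous_intros)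
  have [measurable]: "g \<in> borel_measurable borel" using cont by (rule borel_measurable_continuous_onI)
  have g: "indicator {-K..K} x \<le> g x" "g x \<le> indicator {-(K+1)..K+1} x" "\<bar>g x\<bar> \<le> 1" for x
    by (auto simp: g_def indicator_def)
  have int: "integrable (M n) g" "integrable M' g" for n
  proof -
    interpret real_distribution "M n" by (rule M)
    show "integrable (M n) g" "integrable M' g"
      using g(3) by (auto intro!: integrable_const_bound[where B=1] M'.integrable_const_bound[where B=1])
  qed
  have "bounded (range g)" using g(3) by (auto simp: bounded_iff)
  then have "(\<lambda>n. \<integral>x. g x \<partial>M n) \<longlonglongrightarrow> (\<integral>x. g x \<partial>M')"
    using M(3) cont unfolding weakly_converges_def by blast
  moreover have "1 - \<epsilon> < (\<integral>x. g x \<partial>M')"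
  proof -
    have "measure M' {-K..K} = (\<integral>x. indicator {-K..K} x \<partial>M')" by simp
    also have "\<dots> \<le> (\<integral>x. g x \<partial>M')" using g(1) int(2) by (intro integral_mono) (auto intro: M'.integrable_const_bound[where B=1])
    finally show ?thesis using K by linarith
  qed
  ultimately have "\<forall>\<^sub>F n in sequentially. 1 - \<epsilon> < (\<integral>x. g x \<partial>M n)" by (rule order_tendstoD)
  then have "\<forall>\<^sub>F n in sequentially. measure (M n) {-(K+1)..K+1} > 1 - \<epsilon>"
  proof eventually_elim
    case (elim n)
    interpret real_distribution "M n" by (rule M)
    have "(\<integral>x. g x \<partial>M n) \<le> (\<integral>x. indicator {-(K+1)..K+1} x \<partial>M n)"
      using g(2) int(1) by (intro integral_mono) (auto intro: integrable_const_bound[where B=1])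
    with elim show ?case by simp
  qed
  then show ?thesis by blast
qed

section \<open>Tails of the infinite convolution\<close>

locale admissible_sequence =
  fixes N :: "nat \<Rightarrow> int" and B :: "nat \<Rightarrow> int set"
  assumes admissible: "\<And>k. k \<ge> 1 \<Longrightarrow> admissible_pair (N k) (B k)"
begin

text \<open>\<open>scale 0 n\<close> is the product P_n of the overview. Bases may be negative,
  hence the absolute values in the estimates.\<close>

definition scale :: "nat \<Rightarrow> nat \<Rightarrow> int" where
  "scale n m = (\<Prod>i=n+1..n+m. N i)"

definition mask :: "nat \<Rightarrow> real \<Rightarrow> complex" where
  "mask k = fourier_transform (discrete_uniform ((\<lambda>b. of_int b / of_int (N k)) ` B k))"

text \<open>The sequence of partial convolutions of the rescaled tail after position
  \<open>n\<close>; \<open>partial 0\<close> is that of the whole convolution.\<close>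

definition partial :: "nat \<Rightarrow> nat \<Rightarrow> real measure" where
  "partial n = partial_convolution (tail_factor N B n)"

lemma scale_0 [simp]: "scale n 0 = 1" and scale_Suc: "scale n (Suc m) = scale n m * N (n + Suc m)"
  by (simp_all add: scale_def)

lemma scale_add: "scale n (m + k) = scale n m * scale (n + m) k"
  by (induction k) (simp_all add: scale_Suc add.assoc)

lemma abs_scale_ge: "2 ^ m \<le> \<bar>scale n m\<bar>"
proof (induction m)
  case (Suc m)
  have "\<bar>N (n + Suc m)\<bar> \<ge> 2" using admissible[of "n + Suc m"] by (simp add: admissible_pair_def)
  with Suc have "2 ^ m * 2 \<le> \<bar>scale n m\<bar> * \<bar>N (n + Suc m)\<bar>" by (intro mult_mono) auto
  then show ?case by (simp add: scale_Suc abs_mult)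
qed simp

lemma scale_nonzero [simp]: "scale n m \<noteq> 0"
  using abs_scale_ge[of m n] by (metis abs_zero not_le zero_less_numeral zero_less_power)

lemma
  assumes "k \<ge> 1"
  shows finite_digits: "finite (B k)" and digits_nonempty: "B k \<noteq> {}" and base_nonzero: "N k \<noteq> 0"
  using admissible[OF assms] by (auto simp: admissible_pair_def)

lemma mask_eq:
  assumes "k \<ge> 1"
  shows "mask k x = (\<Sum>b\<in>B k. exp (- 2 * of_real pi * \<i> * of_real (x * (b / N k)))) / card (B k)"
proof -
  have inj: "inj_on (\<lambda>b. real_of_int b / real_of_int (N k)) (B k)"
    using base_nonzero[OF assms] by (auto simp: inj_on_def)
  show ?thesis
    unfolding mask_def using finite_digits[OF assms] digits_nonempty[OF assms]
    by (subst fourier_transform_discrete_uniform) (auto simp: card_image[OF inj] sum.reindex[OF inj])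
qed

lemma real_distribution_tail_factor: "real_distribution (tail_factor N B n k)"
  unfolding tail_factor_def by (rule real_distribution_discrete_uniform)

text \<open>Index shift: factor number \<open>Suc k\<close> is contracted by the \<open>k\<close>
  preceding bases in addition to its own, and its own is already part of
  \<open>mask\<close>.\<close>

lemma fourier_transform_tail_factor:
  "fourier_transform (tail_factor N B n (Suc k)) x = mask (n + Suc k) (x / scale n k)"
proof -
  have "(\<lambda>b. real_of_int b / real_of_int (scale n (Suc k))) ` B (n + Suc k)
      = (\<lambda>y. inverse (scale n k) * y) ` (\<lambda>b. real_of_int b / real_of_int (N (n + Suc k))) ` B (n + Suc k)"
    unfolding image_image by (intro image_cong) (auto simp: scale_Suc divide_inverse)
  then have "tail_factor N B n (Suc k) = discrete_uniform ((\<lambda>y. inverse (scale n k) * y) `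
      (\<lambda>b. real_of_int b / real_of_int (N (n + Suc k))) ` B (n + Suc k))"
    unfolding tail_factor_def scale_def by simp
  moreover have "fourier_transform (discrete_uniform ((\<lambda>y. c * y) ` A)) x = fourier_transform (discrete_uniform A) (x * c)"
    if "finite A" "A \<noteq> {}" "c \<noteq> 0" for A and c :: real
  proof -
    have "inj_on (\<lambda>y. c * y) A" using that by (auto simp: inj_on_def)
    then show ?thesis using that
      by (simp add: fourier_transform_discrete_uniform card_image sum.reindex mult.assoc)
  qed
  ultimately show ?thesis
    using finite_digits[of "n + Suc k"] digits_nonempty[of "n + Suc k"] by (simp add: mask_def divide_inverse)
qed

lemma real_distribution_partial: "real_distribution (partial n m)"
  unfolding partial_def
  by (induction m) (auto intro: real_distribution_return real_distribution_convolution real_distribution_tail_factor)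

lemma fourier_transform_partial_0 [simp]: "fourier_transform (partial n 0) x = 1"
  by (simp add: partial_def fourier_transform_return)

lemma fourier_transform_partial_Suc:
  "fourier_transform (partial n (Suc m)) x = fourier_transform (partial n m) x * mask (n + Suc m) (x / scale n m)"
  using fourier_transform_convolution[OF real_distribution_partial[of n m] real_distribution_tail_factor[of n "Suc m"], of x]
  by (simp add: partial_def fourier_transform_tail_factor)

text \<open>Factorization of a partial convolution into its first \<open>n\<close> factors and a
  contracted tail, in frequency form. Every comparison between the whole convolution and its tails
  rests on it.\<close>

lemma fourier_transform_partial_add:
  "fourier_transform (partial 0 (n + m)) x =
    fourier_transform (partial 0 n) x * fourier_transform (partial n m) (x / scale 0 n)"
  by (induction m) (simp_all add: fourier_transform_partial_Suc scale_add)

text \<open>Each factor is a finite exponential sum and makes sense for complex arguments. The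
  extension gives access to the identity theorem.\<close>

lemma fourier_transform_partial_entire:
  "\<exists>F. F holomorphic_on UNIV \<and> (\<forall>x. F (of_real x) = fourier_transform (partial n m) x)"
proof (induction m)
  case 0
  show ?case by (intro exI[of _ "\<lambda>_. 1"]) simp
next
  case (Suc m)
  then obtain F where F: "F holomorphic_on UNIV" "\<And>x. F (of_real x) = fourier_transform (partial n m) x" by blast
  let ?k = "n + Suc m"
  let ?G = "\<lambda>z :: complex. F z * ((\<Sum>b\<in>B ?k. exp (- 2 * of_real pi * \<i> * (z / of_int (scale n m) * (of_int b / of_int (N ?k))))) / of_nat (card (B ?k)))"
  have "?G holomorphic_on UNIV"
    using F(1) digits_nonempty[of ?k] finite_digits[of ?k] base_nonzero[of ?k] by (intro holomorphic_intros) auto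
  moreover have "?G (of_real x) = fourier_transform (partial n (Suc m)) x" for x
    by (simp add: F(2) fourier_transform_partial_Suc mask_eq)
  ultimately show ?case by blast
qed

text \<open>The zeros of an entire function are isolated, so \<open>g\<close> and \<open>h\<close> agree on a dense set.\<close>

lemma fourier_transform_partial_cancel:
  assumes "continuous_on UNIV g" "continuous_on UNIV h"
    and eq: "\<And>x. fourier_transform (partial n m) x * g x = fourier_transform (partial n m) x * h x"
  shows "g x = h (x :: real)"
proof (rule ccontr)
  assume "g x \<noteq> h x"
  obtain F where F: "F holomorphic_on UNIV" "\<And>x. F (of_real x) = fourier_transform (partial n m) x"
    using fourier_transform_partial_entire by blast
  let ?S = "{y. g y \<noteq> h y}"
  have "open ?S" by (rule open_Collect_neq[OF assms(1,2)])
  then have "x islimpt ?S" using \<open>g x \<noteq> h x\<close> by (simp add: interior_limit_point interior_open)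
  then have "(of_real x :: complex) islimpt of_real ` ?S"
    by (rule islimpt_isCont_image) (auto simp: eventually_at_filter)
  moreover have "F z = 0" if z: "z \<in> of_real ` ?S" for z :: complex
  proof -
    obtain y where "z = of_real y" "g y \<noteq> h y" using z by blast
    then show ?thesis using eq[of y] F(2)[of y] by simp
  qed
  ultimately have "F 0 = 0"
    by (rule analytic_continuation[OF F(1) open_UNIV connected_UNIV subset_UNIV UNIV_I _ _ UNIV_I])
  moreover have "F 0 = 1"
    using F(2)[of 0] fourier_transform_0[OF real_distribution_partial] by simp
  ultimately show False by simp
qed

end

section \<open>Existence of the tails of a convergent infinite convolution\<close>

locale convergent_admissible_sequence = admissible_sequence +
  fixes \<mu> :: "real measure"
  assumes convolution: "has_infinite_convolution (tail_factor N B 0) \<mu>"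
begin

lemma real_distribution_limit: "real_distribution \<mu>"
  and partial_converges: "weakly_converges (partial 0) \<mu>"
  using convolution by (simp_all add: has_infinite_convolution_def partial_def)

lemma fourier_transform_partial_tendsto:
  "(\<lambda>m. fourier_transform (partial 0 m) x) \<longlonglongrightarrow> fourier_transform \<mu> x"
  using real_distribution_partial real_distribution_limit partial_converges
  by (rule weakly_converges_fourier_transform)

text \<open>Mass escaping from the tail would have to escape from the whole convolution as well: the
  first \<open>n\<close> factors form a fixed measure, nearly all of whose mass lies in a bounded
  interval, and the whole convolution converges.\<close>

lemma tight_partial: "tight (partial n)"
proof (rule tight_eventuallyI)
  fix \<epsilon> :: real assume "\<epsilon> > 0"
  then have \<epsilon>: "\<epsilon> / 2 > 0" by simp
  obtain K where K: "\<forall>\<^sub>F m in sequentially. measure (partial 0 m) {-K..K} > 1 - \<epsilon> / 2"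
    using weakly_converges_eventually_interval[OF real_distribution_partial real_distribution_limit partial_converges \<epsilon>] by blast
  interpret real_distribution "partial 0 n" by (rule real_distribution_partial)
  obtain r where r: "measure (partial 0 n) {-r..r} > 1 - \<epsilon> / 2"
    using ex_symmetric_interval[OF \<epsilon>] by blast
  define c where "c = 1 / real_of_int (scale 0 n)"
  \<comment> \<open>Undoing the contraction by P_n stretches the interval of radius
    \<open>K + r\<close>; absolute values because P_n may be negative.\<close>
  define C where "C = \<bar>K + r\<bar> * \<bar>scale 0 n\<bar>"
  have "c \<noteq> 0" by (simp add: c_def)
  have "\<forall>\<^sub>F m in sequentially. measure (partial 0 (m + n)) {-K..K} > 1 - \<epsilon> / 2"
    using K by (rule eventually_compose_filterlim) (rule filterlim_add_const_nat_at_top)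
  then have "\<forall>\<^sub>F m in sequentially. measure (partial n m) {-C..C} > 1 - \<epsilon>"
  proof eventually_elim
    case (elim m)
    interpret T: real_distribution "partial n m" by (rule real_distribution_partial)
    have c: "x / scale 0 n = c * x" for x by (simp add: c_def)
    let ?R = "distr (partial n m) borel (\<lambda>x. c * x)"
    have R: "real_distribution ?R" by (rule T.real_distribution_distr) simp
    have "partial 0 (m + n) = (partial 0 n \<star> ?R)"
      by (intro fourier_transform_eqD real_distribution_partial real_distribution_convolution R)
        (simp add: fourier_transform_convolution real_distribution_partial R fourier_transform_distr_scale
          fourier_transform_partial_add add.commute[of m] c)
    then have "1 - \<epsilon> / 2 < measure ?R {-(K + r)..K + r} + measure (partial 0 n) (- {-r..r})"
      using elim measure_convolution_le[OF real_distribution_partial R, of 0 n K r] by simp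
    also have "measure (partial 0 n) (- {-r..r}) = 1 - measure (partial 0 n) {-r..r}"
      using prob_compl[of "{-r..r}"] by (simp add: Compl_eq_Diff_UNIV)
    also have "measure ?R {-(K + r)..K + r} \<le> measure (partial n m) {-C..C}"
    proof -
      have "x \<in> {-C..C}" if "c * x \<in> {-(K + r)..K + r}" for x
      proof -
        have "\<bar>c * x\<bar> \<le> \<bar>K + r\<bar>" using that by auto
        then have "\<bar>x\<bar> \<le> C" by (simp add: c_def C_def abs_mult field_simps)
        then show ?thesis by auto
      qed
      then show ?thesis
        by (subst measure_distr) (auto intro!: T.finite_measure_mono)
    qed
    finally show ?case using r by linarith
  qed
  then show "\<exists>K. \<forall>\<^sub>F m in sequentially. measure (partial n m) {-K..K} > 1 - \<epsilon>" by blast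
qed (rule real_distribution_partial)

text \<open>The factorization passes to the limit along \<open>s\<close>. It determines the
  transform of \<rho> wherever that of \<open>partial 0 n\<close> does not vanish at the matching
  frequency.\<close>

lemma subsequential_tail:
  assumes "strict_mono s" "real_distribution \<rho>" "weak_conv_m (partial n \<circ> s) \<rho>"
  shows "fourier_transform \<mu> x = fourier_transform (partial 0 n) x * fourier_transform \<rho> (x / scale 0 n)"
proof -
  have "(\<lambda>m. fourier_transform ((partial n \<circ> s) m) (x / scale 0 n)) \<longlonglongrightarrow> fourier_transform \<rho> (x / scale 0 n)"
    unfolding fourier_transform_eq_char
    by (rule levy_continuity1[OF _ assms(2,3)]) (simp add: real_distribution_partial)
  then have "(\<lambda>m. fourier_transform (partial 0 n) x * fourier_transform (partial n (s m)) (x / scale 0 n))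
      \<longlonglongrightarrow> fourier_transform (partial 0 n) x * fourier_transform \<rho> (x / scale 0 n)"
    by (auto intro!: tendsto_intros)
  moreover have "filterlim (\<lambda>m. n + s m) at_top sequentially"
    by (rule filterlim_at_top_mono[OF filterlim_subseq[OF assms(1)]]) simp
  then have "(\<lambda>m. fourier_transform (partial 0 (n + s m)) x) \<longlonglongrightarrow> fourier_transform \<mu> x"
    by (rule filterlim_compose[OF fourier_transform_partial_tendsto])
  ultimately show ?thesis
    by (simp add: fourier_transform_partial_add LIMSEQ_unique)
qed

text \<open>Only the whole convolution is assumed to converge, and
  \<open>infinite_convolution\<close> is a definite description, so the tails must be shown to
  converge. Any two subsequential limits have equal transforms after cancelling the one of
  \<open>partial 0 n\<close>, and a tight sequence with a single subsequential limit
  converges.\<close>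

lemma ex_tail:
  "\<exists>\<rho>. has_infinite_convolution (tail_factor N B n) \<rho> \<and>
     (\<forall>x. fourier_transform \<mu> x = fourier_transform (partial 0 n) x * fourier_transform \<rho> (x / scale 0 n))"
proof -
  obtain r \<rho> where r: "strict_mono r" "real_distribution \<rho>" "weak_conv_m (partial n \<circ> r) \<rho>"
    using tight_imp_convergent_subsubsequence[OF tight_partial[of n] strict_mono_id] by auto
  have "weak_conv_m (partial n) \<rho>"
  proof (rule tight_subseq_weak_converge[OF real_distribution_partial r(2) tight_partial])
    fix s \<rho>' assume s: "strict_mono s" "real_distribution \<rho>'" "weak_conv_m (partial n \<circ> s) \<rho>'"
    have cont: "continuous_on UNIV (\<lambda>x. fourier_transform M (x / scale 0 n))" if "real_distribution M" for M
      by (rule continuous_on_compose2[OF continuous_fourier_transform[OF that]]) (auto intro!: continuous_intros)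
    have "fourier_transform \<rho>' (x / scale 0 n) = fourier_transform \<rho> (x / scale 0 n)" for x
      by (rule fourier_transform_partial_cancel[OF cont[OF s(2)] cont[OF r(2)], of 0 n])
        (simp add: subsequential_tail[OF s, symmetric] subsequential_tail[OF r, symmetric])
    \<comment> \<open>The substitution undoes the division by P_n, which is nonzero.\<close>
    from this[of "y * real_of_int (scale 0 n)" for y] have "fourier_transform \<rho>' x = fourier_transform \<rho> x" for x by simp
    then have "\<rho>' = \<rho>" by (intro fourier_transform_eqD s r)
    with s show "weak_conv_m (partial n \<circ> s) \<rho>" by simp
  qed
  then have "has_infinite_convolution (tail_factor N B n) \<rho>"
    using r(2) weakly_converges_iff_weak_conv_m[OF real_distribution_partial r(2)]
    by (simp add: has_infinite_convolution_def partial_def)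
  then show ?thesis using subsequential_tail[OF r] by blast
qed

definition tail :: "nat \<Rightarrow> real measure" where
  "tail n = infinite_convolution (tail_factor N B n)"

lemma real_distribution_tail: "real_distribution (tail n)"
  and fourier_transform_tail:
    "fourier_transform \<mu> x = fourier_transform (partial 0 n) x * fourier_transform (tail n) (x / scale 0 n)"
proof -
  obtain \<rho> where \<rho>: "has_infinite_convolution (tail_factor N B n) \<rho>"
     "\<And>x. fourier_transform \<mu> x = fourier_transform (partial 0 n) x * fourier_transform \<rho> (x / scale 0 n)"
    using ex_tail by blast
  have "tail n = \<rho>"
    unfolding tail_def by (rule infinite_convolution_eqI[OF real_distribution_tail_factor \<rho>(1)])
  then show "real_distribution (tail n)"
    "fourier_transform \<mu> x = fourier_transform (partial 0 n) x * fourier_transform (tail n) (x / scale 0 n)"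
    using \<rho> by (simp_all add: has_infinite_convolution_def)
qed

end

section \<open>Equicontinuity and equipositivity\<close>

text \<open>Two kernels at frequencies less than \<open>h\<close> apart differ at \<open>t\<close>
  by at most \<open>g h t\<close>. The cap 2 makes \<open>g h\<close> bounded, so a bound on its
  integral for the limit measure carries over to eventually all measures; dominated convergence
  supplies a suitable \<open>h\<close>.\<close>

lemma fourier_transform_equicontinuous:
  assumes M: "\<And>n. real_distribution (M n)" "real_distribution M'" "weakly_converges M M'" and "\<eta> > 0"
  shows "\<exists>\<delta>>0. \<forall>\<^sub>F n in sequentially. \<forall>x y. \<bar>x - y\<bar> < \<delta> \<longrightarrow>
    cmod (fourier_transform (M n) x - fourier_transform (M n) y) < \<eta>"
proof -
  interpret M': real_distribution M' by fact
  define g where "g h x = min 2 \<bar>2 * pi * h * x\<bar>" for h x :: real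
  have cont: "continuous_on UNIV (g h)" for h unfolding g_def by (intro continuous_intros)
  have [measurable]: "g h \<in> borel_measurable borel" for h using cont by (rule borel_measurable_continuous_onI)
  have g2: "\<bar>g h x\<bar> \<le> 2" for h x by (simp add: g_def)
  have "(\<lambda>k. \<integral>x. g (1 / Suc k) x \<partial>M') \<longlonglongrightarrow> (\<integral>x. 0 \<partial>M')"
  proof (rule integral_dominated_convergence[where w="\<lambda>_. 2"])
    have "(\<lambda>k. g (1 / Suc k) x) \<longlonglongrightarrow> min 2 \<bar>2 * pi * 0 * x\<bar>" for x
      unfolding g_def by (intro tendsto_intros LIMSEQ_Suc[OF lim_1_over_n])
    then show "AE x in M'. (\<lambda>k. g (1 / Suc k) x) \<longlonglongrightarrow> 0" by simp
  qed (use g2 in auto)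
  then have "\<forall>\<^sub>F k in sequentially. (\<integral>x. g (1 / Suc k) x \<partial>M') < \<eta>"
    using \<open>\<eta> > 0\<close> by (intro order_tendstoD(2)[of _ 0]) auto
  then obtain k where k: "(\<integral>x. g (1 / Suc k) x \<partial>M') < \<eta>" by (auto simp: eventually_sequentially)
  define h where "h = 1 / real (Suc k)"
  have "h > 0" by (simp add: h_def)
  have "bounded (range (g h))" using g2 by (auto simp: bounded_iff)
  then have "(\<lambda>n. \<integral>x. g h x \<partial>M n) \<longlonglongrightarrow> (\<integral>x. g h x \<partial>M')"
    using M(3) cont unfolding weakly_converges_def by blast
  then have "\<forall>\<^sub>F n in sequentially. (\<integral>x. g h x \<partial>M n) < \<eta>"
    using k unfolding h_def by (rule order_tendstoD)
  then have "\<forall>\<^sub>F n in sequentially. \<forall>x y. \<bar>x - y\<bar> < h \<longrightarrow>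
    cmod (fourier_transform (M n) x - fourier_transform (M n) y) < \<eta>"
  proof eventually_elim
    case (elim n)
    interpret real_distribution "M n" by (rule M)
    show ?case
    proof (intro allI impI)
      fix x y :: real assume xy: "\<bar>x - y\<bar> < h"
      let ?e = "\<lambda>x t. exp (- 2 * of_real pi * \<i> * of_real (x * t))"
      have int: "integrable (M n) (?e x)" for x
        by (rule integrable_const_bound[where B=1]) (auto simp: norm_exp_eq_Re)
      have bound: "cmod (?e x t - ?e y t) \<le> g h t" for t
      proof -
        have "?e x t - ?e y t = ?e y t * (iexp (- 2 * pi * (x - y) * t) - 1)"
          by (simp add: exp_add[symmetric] algebra_simps)
        then have eq: "cmod (?e x t - ?e y t) = cmod (iexp (- 2 * pi * (x - y) * t) - 1)"
          by (simp add: norm_mult norm_exp_eq_Re)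
        have "cmod (?e x t - ?e y t) \<le> \<bar>- 2 * pi * (x - y) * t\<bar>"
          unfolding eq using iexp_approx1[of "- 2 * pi * (x - y) * t" 0] by simp
        also have "\<dots> = (2 * pi * \<bar>t\<bar>) * \<bar>x - y\<bar>" by (simp add: abs_mult)
        also have "\<dots> \<le> (2 * pi * \<bar>t\<bar>) * h" using xy by (intro mult_left_mono) auto
        finally have "cmod (?e x t - ?e y t) \<le> \<bar>2 * pi * h * t\<bar>"
          using \<open>h > 0\<close> by (simp add: abs_mult mult_ac)
        moreover have "cmod (?e x t - ?e y t) \<le> 2"
          using norm_triangle_ineq4[of "?e x t" "?e y t"] by (simp add: norm_exp_eq_Re)
        ultimately show ?thesis by (simp add: g_def)
      qed
      have "cmod (fourier_transform (M n) x - fourier_transform (M n) y) = cmod (\<integral>t. ?e x t - ?e y t \<partial>M n)"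
        unfolding fourier_transform_def by (subst Bochner_Integration.integral_diff[OF int int]) simp
      also have "\<dots> \<le> (\<integral>t. cmod (?e x t - ?e y t) \<partial>M n)" by (rule integral_norm_bound)
      also have "\<dots> \<le> (\<integral>t. g h t \<partial>M n)"
      proof (rule integral_mono)
        show "integrable (M n) (\<lambda>t. cmod (?e x t - ?e y t))"
          using int by (intro integrable_norm Bochner_Integration.integrable_diff)
        show "integrable (M n) (g h)"
          using g2 by (intro integrable_const_bound[where B=2]) auto
      qed (rule bound)
      finally show "cmod (fourier_transform (M n) x - fourier_transform (M n) y) < \<eta>" using elim by simp
    qed
  qed
  with \<open>h > 0\<close> show ?thesis by blast
qed

lemma fourier_transform_locally_bounded_below:
  assumes M: "\<And>n. real_distribution (M n)" "real_distribution M'" "weakly_converges M M'"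
    and nz: "fourier_transform M' x \<noteq> 0"
  shows "\<exists>\<epsilon>>0. \<exists>\<delta>>0. \<forall>\<^sub>F n in sequentially. \<forall>y. \<bar>y - x\<bar> < \<delta> \<longrightarrow> \<epsilon> \<le> cmod (fourier_transform (M n) y)"
proof -
  \<comment> \<open>A third: the modulus at \<open>x\<close> eventually exceeds twice \<epsilon>,
    and moving by less than \<delta> costs less than \<epsilon>.\<close>
  define \<epsilon> where "\<epsilon> = cmod (fourier_transform M' x) / 3"
  have "\<epsilon> > 0" using nz by (simp add: \<epsilon>_def)
  then obtain \<delta> where "\<delta> > 0" and \<delta>: "\<forall>\<^sub>F n in sequentially. \<forall>x y. \<bar>x - y\<bar> < \<delta> \<longrightarrow>
      cmod (fourier_transform (M n) x - fourier_transform (M n) y) < \<epsilon>"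
    using fourier_transform_equicontinuous[OF M] by blast
  have "(\<lambda>n. cmod (fourier_transform (M n) x)) \<longlonglongrightarrow> cmod (fourier_transform M' x)"
    by (intro tendsto_norm weakly_converges_fourier_transform M)
  then have "\<forall>\<^sub>F n in sequentially. 2 * \<epsilon> < cmod (fourier_transform (M n) x)"
    using \<open>\<epsilon> > 0\<close> by (intro order_tendstoD(1)) (auto simp: \<epsilon>_def)
  with \<delta> have "\<forall>\<^sub>F n in sequentially. \<forall>y. \<bar>y - x\<bar> < \<delta> \<longrightarrow> \<epsilon> \<le> cmod (fourier_transform (M n) y)"
  proof eventually_elim
    case (elim n)
    show ?case
    proof (intro allI impI)
      fix y assume "\<bar>y - x\<bar> < \<delta>"
      then have "cmod (fourier_transform (M n) x - fourier_transform (M n) y) < \<epsilon>"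
        using elim(1) by (simp add: abs_minus_commute)
      then show "\<epsilon> \<le> cmod (fourier_transform (M n) y)"
        using elim(2) norm_triangle_sub[of "fourier_transform (M n) x" "fourier_transform (M n) y"] by linarith
    qed
  qed
  with \<open>\<epsilon> > 0\<close> \<open>\<delta> > 0\<close> show ?thesis by blast
qed

text \<open>Compactness in the form of bisection: the property passes to adjoining intervals by
  taking minima and holds on short intervals around each point. The integer \<open>k\<close> may
  depend on \<open>n\<close> and \<open>x\<close>, while \<epsilon> and \<delta> may not.\<close>

lemma fourier_transform_equipositive_interval:
  assumes M: "\<And>n. real_distribution (M n)" "real_distribution M'" "weakly_converges M M'"
    and Z: "integral_periodic_zero_set M' = {}" and "a \<le> b"
  shows "\<exists>\<epsilon>>0. \<exists>\<delta>>0. \<forall>\<^sub>F n in sequentially. \<forall>x\<in>{a..b}. \<exists>k::int. \<forall>y. \<bar>y\<bar> < \<delta> \<longrightarrow>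
    \<epsilon> \<le> cmod (fourier_transform (M n) (x + k + y))"
  using \<open>a \<le> b\<close>
proof (induction rule: Bolzano)
  case (trans a b c)
  then obtain \<epsilon> \<delta> \<epsilon>' \<delta>' where pos: "\<epsilon> > 0" "\<delta> > 0" "\<epsilon>' > 0" "\<delta>' > 0"
    and ev: "\<forall>\<^sub>F n in sequentially. \<forall>x\<in>{a..b}. \<exists>k::int. \<forall>y. \<bar>y\<bar> < \<delta> \<longrightarrow>
        \<epsilon> \<le> cmod (fourier_transform (M n) (x + k + y))"
      "\<forall>\<^sub>F n in sequentially. \<forall>x\<in>{b..c}. \<exists>k::int. \<forall>y. \<bar>y\<bar> < \<delta>' \<longrightarrow>
        \<epsilon>' \<le> cmod (fourier_transform (M n) (x + k + y))"
    by blast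
  from ev have "\<forall>\<^sub>F n in sequentially. \<forall>x\<in>{a..c}. \<exists>k::int. \<forall>y. \<bar>y\<bar> < min \<delta> \<delta>' \<longrightarrow>
        min \<epsilon> \<epsilon>' \<le> cmod (fourier_transform (M n) (x + k + y))"
  proof eventually_elim
    case (elim n)
    show ?case
    proof
      fix x assume "x \<in> {a..c}"
      then consider "x \<in> {a..b}" | "x \<in> {b..c}" by fastforce
      then show "\<exists>k::int. \<forall>y. \<bar>y\<bar> < min \<delta> \<delta>' \<longrightarrow> min \<epsilon> \<epsilon>' \<le> cmod (fourier_transform (M n) (x + k + y))"
        using elim by cases (meson min_less_iff_conj min.coboundedI1 min.coboundedI2)+
    qed
  qed
  moreover have "min \<epsilon> \<epsilon>' > 0" "min \<delta> \<delta>' > 0" using pos by auto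
  ultimately show ?case by blast
next
  case (local x)
  obtain k :: int where k: "fourier_transform M' (x + k) \<noteq> 0"
    using Z unfolding integral_periodic_zero_set_def by blast
  obtain \<epsilon> \<delta> where pos: "\<epsilon> > 0" "\<delta> > 0"
    and ev: "\<forall>\<^sub>F n in sequentially. \<forall>y. \<bar>y - (x + k)\<bar> < \<delta> \<longrightarrow> \<epsilon> \<le> cmod (fourier_transform (M n) y)"
    using fourier_transform_locally_bounded_below[OF M k] by blast
  \<comment> \<open>Half of \<delta> is spent on the distance from \<open>x\<close> to
    \<open>z\<close>, half on \<open>y\<close>.\<close>
  have "\<forall>\<^sub>F n in sequentially. \<forall>z\<in>{a..b}. \<exists>k::int. \<forall>y. \<bar>y\<bar> < \<delta> / 2 \<longrightarrow>
        \<epsilon> \<le> cmod (fourier_transform (M n) (z + k + y))" if ab: "a \<le> x \<and> x \<le> b \<and> b - a < \<delta> / 2" for a b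
    using ev
  proof eventually_elim
    case (elim n)
    have "\<epsilon> \<le> cmod (fourier_transform (M n) (z + k + y))" if "z \<in> {a..b}" "\<bar>y\<bar> < \<delta> / 2" for z y
    proof -
      have "\<bar>z + k + y - (x + k)\<bar> < \<delta>" using ab that by (auto simp: abs_less_iff)
      then show ?thesis using elim by blast
    qed
    then show ?case by blast
  qed
  moreover have "\<delta> / 2 > 0" using pos by simp
  ultimately show ?case using pos by blast
qed

lemma fourier_transform_equipositive:
  assumes M: "\<And>n. real_distribution (M n)" "real_distribution M'" "weakly_converges M M'"
    and Z: "integral_periodic_zero_set M' = {}"
  shows "\<exists>\<epsilon>>0. \<exists>\<delta>>0. \<forall>\<^sub>F n in sequentially.
    (\<forall>x. \<exists>k::int. \<forall>y. \<bar>y\<bar> < \<delta> \<longrightarrow> \<epsilon> \<le> cmod (fourier_transform (M n) (x + k + y))) \<and>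
    (\<forall>y. \<bar>y\<bar> < \<delta> \<longrightarrow> \<epsilon> \<le> cmod (fourier_transform (M n) y))"
proof -
  obtain \<epsilon> \<delta> where pos: "\<epsilon> > 0" "\<delta> > 0"
    and ev: "\<forall>\<^sub>F n in sequentially. \<forall>x\<in>{0..1}. \<exists>k::int. \<forall>y. \<bar>y\<bar> < \<delta> \<longrightarrow>
        \<epsilon> \<le> cmod (fourier_transform (M n) (x + k + y))"
    using fourier_transform_equipositive_interval[OF M Z zero_le_one] by blast
  have "fourier_transform M' 0 \<noteq> 0" using M(2) by (simp add: fourier_transform_0)
  then obtain \<epsilon>' \<delta>' where pos': "\<epsilon>' > 0" "\<delta>' > 0"
    and ev': "\<forall>\<^sub>F n in sequentially. \<forall>y. \<bar>y - 0\<bar> < \<delta>' \<longrightarrow> \<epsilon>' \<le> cmod (fourier_transform (M n) y)"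
    using fourier_transform_locally_bounded_below[OF M] by blast
  from ev ev' have "\<forall>\<^sub>F n in sequentially.
    (\<forall>x. \<exists>k::int. \<forall>y. \<bar>y\<bar> < min \<delta> \<delta>' \<longrightarrow> min \<epsilon> \<epsilon>' \<le> cmod (fourier_transform (M n) (x + k + y))) \<and>
    (\<forall>y. \<bar>y\<bar> < min \<delta> \<delta>' \<longrightarrow> min \<epsilon> \<epsilon>' \<le> cmod (fourier_transform (M n) y))"
  proof eventually_elim
    case (elim n)
    have "\<exists>k::int. \<forall>y. \<bar>y\<bar> < min \<delta> \<delta>' \<longrightarrow> min \<epsilon> \<epsilon>' \<le> cmod (fourier_transform (M n) (x + k + y))" for x
    proof -
      have "frac x \<in> {0..1}" using frac_ge_0[of x] frac_lt_1[of x] by simp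
      then obtain k :: int where k: "\<And>y. \<bar>y\<bar> < \<delta> \<Longrightarrow> \<epsilon> \<le> cmod (fourier_transform (M n) (frac x + k + y))"
        using elim(1) by blast
      have "x + (k - \<lfloor>x\<rfloor>) + y = frac x + k + y" for y by (simp add: frac_def)
      with k have "min \<epsilon> \<epsilon>' \<le> cmod (fourier_transform (M n) (x + (k - \<lfloor>x\<rfloor>) + y))" if "\<bar>y\<bar> < min \<delta> \<delta>'" for y
        using that by (metis min.coboundedI1 min_less_iff_conj)
      then show ?thesis by blast
    qed
    then show ?case using elim(2) by (auto intro: min.coboundedI2)
  qed
  moreover have "min \<epsilon> \<epsilon>' > 0" "min \<delta> \<delta>' > 0" using pos pos' by auto
  ultimately show ?thesis by blast
qed

section \<open>Spectra of the partial convolutions\<close>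

lemma L2_inner_wave: "L2_inner \<mu> (wave \<xi>) (wave \<eta>) = fourier_transform \<mu> (\<eta> - \<xi>)"
proof -
  have "wave \<xi> x * cnj (wave \<eta> x) = exp (- 2 * of_real pi * \<i> * of_real ((\<eta> - \<xi>) * x))" for x
    by (simp add: wave_def exp_cnj exp_add[symmetric] algebra_simps)
  then show ?thesis by (simp only: L2_inner_def fourier_transform_def)
qed

lemma is_spectrum_iff_wave: "is_spectrum \<mu> \<Lambda> \<longleftrightarrow> L2_orthonormal_basis \<mu> \<Lambda> wave"
  by (simp only: is_spectrum_def wave_def[abs_def])

text \<open>Exponentials have norm 1, and the transform at \<open>- \<xi>\<close> is the conjugate
  of that at \<xi>, so orthonormality reduces to zeros at differences, of either sign.\<close>

lemma is_spectrum_iff_approximable: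
  assumes "real_distribution \<mu>"
  shows "is_spectrum \<mu> \<Lambda> \<longleftrightarrow>
    (\<forall>l\<in>\<Lambda>. \<forall>l'\<in>\<Lambda>. l \<noteq> l' \<longrightarrow> fourier_transform \<mu> (l - l') = 0) \<and>
    (\<forall>f. square_integrable \<mu> f \<longrightarrow> approximable \<mu> \<Lambda> wave f)"
proof -
  have "fourier_transform \<mu> (l' - l) = (if l = l' then 1 else 0) \<longleftrightarrow>
      (l \<noteq> l' \<longrightarrow> fourier_transform \<mu> (l - l') = 0)" for l l'
    using fourier_transform_0[OF assms] fourier_transform_minus[of \<mu> "l - l'"] by auto
  then show ?thesis
    unfolding is_spectrum_iff_wave L2_orthonormal_basis_def approximable_def[abs_def] L2_inner_wave
    using square_integrable_wave[OF assms] by simp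
qed

lemma L2_norm_wave:
  assumes "real_distribution \<mu>" shows "(\<integral>x. (cmod (wave \<xi> x))\<^sup>2 \<partial>\<mu>) = 1"
  using real_distribution.space_eq_univ[OF assms] prob_space.prob_space[OF real_distribution.axioms(1)[OF assms]]
  by simp

lemma L2_norm_wave_diff_orthogonal:
  assumes "real_distribution \<mu>" "finite F"
    and "\<And>l l'. l \<in> F \<Longrightarrow> l' \<in> F \<Longrightarrow> l \<noteq> l' \<Longrightarrow> fourier_transform \<mu> (l - l') = 0"
  shows "(\<integral>x. (cmod (wave \<xi> x - (\<Sum>l\<in>F. c l * wave l x)))\<^sup>2 \<partial>\<mu>) =
    1 - (\<Sum>l\<in>F. (cmod (fourier_transform \<mu> (l - \<xi>)))\<^sup>2) +
    (\<Sum>l\<in>F. (cmod (c l - fourier_transform \<mu> (l - \<xi>)))\<^sup>2)"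
proof -
  have "(\<integral>x. (cmod (wave \<xi> x - (\<Sum>l\<in>F. c l * wave l x)))\<^sup>2 \<partial>\<mu>) =
    (\<integral>x. (cmod (wave \<xi> x))\<^sup>2 \<partial>\<mu>) - (\<Sum>l\<in>F. (cmod (L2_inner \<mu> (wave \<xi>) (wave l)))\<^sup>2) +
    (\<Sum>l\<in>F. (cmod (c l - L2_inner \<mu> (wave \<xi>) (wave l)))\<^sup>2)"
    using assms fourier_transform_0[OF assms(1)]
    by (intro L2_norm_diff_orthonormal square_integrable_wave) (auto simp: L2_inner_wave)
  then show ?thesis unfolding L2_norm_wave[OF assms(1)] L2_inner_wave .
qed

lemma Bessel_fourier_transform:
  assumes "real_distribution \<mu>" "finite F"
    and "\<And>l l'. l \<in> F \<Longrightarrow> l' \<in> F \<Longrightarrow> l \<noteq> l' \<Longrightarrow> fourier_transform \<mu> (l - l') = 0"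
  shows "(\<Sum>l\<in>F. (cmod (fourier_transform \<mu> (l - \<xi>)))\<^sup>2) \<le> 1"
proof -
  have "0 \<le> (\<integral>x. (cmod (wave \<xi> x - (\<Sum>l\<in>F. fourier_transform \<mu> (l - \<xi>) * wave l x)))\<^sup>2 \<partial>\<mu>)" by simp
  with L2_norm_wave_diff_orthogonal[OF assms, of \<xi> "\<lambda>l. fourier_transform \<mu> (l - \<xi>)"] show ?thesis by simp
qed

text \<open>The Jorgensen-Pedersen criterion for finite sets of integers: orthogonality together
  with Parseval's identity for every exponential. It depends on the measure only through its
  transform \<phi> and thus combines well with products and periods of transforms.\<close>

definition finite_spectrum :: "(real \<Rightarrow> complex) \<Rightarrow> real set \<Rightarrow> bool" where
  "finite_spectrum \<phi> \<Lambda> \<longleftrightarrow> finite \<Lambda> \<and> \<Lambda> \<subseteq> \<int> \<and>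
     (\<forall>l\<in>\<Lambda>. \<forall>l'\<in>\<Lambda>. l \<noteq> l' \<longrightarrow> \<phi> (l - l') = 0) \<and>
     (\<forall>\<xi>. (\<Sum>l\<in>\<Lambda>. (cmod (\<phi> (l - \<xi>)))\<^sup>2) = 1)"

text \<open>Bessel's inequality for the indicator of one point: its squared norm is 1 / #A and all
  its coefficients have modulus 1 / #A, so there are at most #A of them.\<close>

lemma spectrum_discrete_uniform_finite:
  assumes A: "finite A" "A \<noteq> {}" and L: "is_spectrum (discrete_uniform A) L"
  shows "finite L"
proof -
  obtain a where "a \<in> A" using A by blast
  let ?\<mu> = "discrete_uniform A"
  let ?f = "\<lambda>x. indicator {a} x :: complex"
  have card: "card A > 0" using A by (simp add: card_gt_0_iff)
  have \<mu>: "real_distribution ?\<mu>" by (rule real_distribution_discrete_uniform)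
  have sq: "square_integrable ?\<mu> ?f"
    by (rule square_integrable_bounded[OF \<mu>, where C=1]) (auto simp: indicator_def)
  have orth: "L2_inner ?\<mu> (wave l) (wave l') = (if l = l' then 1 else 0)" if "l \<in> L" "l' \<in> L" for l l'
    using L that unfolding is_spectrum_iff_wave L2_orthonormal_basis_def by blast
  have "card F \<le> card A" if F: "F \<subseteq> L" "finite F" for F
  proof -
    have "(\<Sum>l\<in>F. (cmod (L2_inner ?\<mu> ?f (wave l)))\<^sup>2) \<le> (\<integral>x. (cmod (?f x))\<^sup>2 \<partial>?\<mu>)"
      using F by (intro Bessel_inequality sq square_integrable_wave \<mu> orth) auto
    also have "(\<integral>x. (cmod (?f x))\<^sup>2 \<partial>?\<mu>) = 1 / card A"
    proof -
      have "(\<Sum>x\<in>A. (cmod (?f x))\<^sup>2) = (\<Sum>x\<in>A. if x = a then 1 else 0)"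
        by (intro sum.cong) (auto simp: indicator_def)
      then show ?thesis using A \<open>a \<in> A\<close> by (subst integral_discrete_uniform) auto
    qed
    finally have "(\<Sum>l\<in>F. (cmod (L2_inner ?\<mu> ?f (wave l)))\<^sup>2) \<le> 1 / card A" .
    moreover have "cmod (L2_inner ?\<mu> ?f (wave l)) = 1 / card A" for l
    proof -
      have "(\<Sum>x\<in>A. ?f x * cnj (wave l x)) = (\<Sum>x\<in>A. if x = a then cnj (wave l a) else 0)"
        by (intro sum.cong) (auto simp: indicator_def)
      moreover have "(\<lambda>x. ?f x * cnj (wave l x)) \<in> borel_measurable borel"
        by (intro borel_measurable_times borel_measurable_indicator borel_measurable_continuous_onI
            continuous_on_cnj continuous_wave) auto
      ultimately show ?thesis
        unfolding L2_inner_def using A \<open>a \<in> A\<close>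
        by (subst integral_discrete_uniform) (auto simp: norm_divide)
    qed
    ultimately have "real (card F) * (1 / card A)\<^sup>2 \<le> 1 / card A" by simp
    then have "real (card F) \<le> card A" using card by (simp add: power2_eq_square field_simps)
    then show ?thesis by simp
  qed
  then show ?thesis by (meson finite_if_finite_subsets_card_bdd)
qed

text \<open>The sum is at most 1 by Bessel's inequality. Conversely, an approximation of
  \<open>wave \<xi>\<close> by any combination over \<open>F\<close> has error at least 1 minus the
  sum over \<open>F\<close>, and the error can be made arbitrarily small.\<close>

lemma finite_spectrum_discrete_uniform:
  assumes A: "finite A" "A \<noteq> {}" and L: "is_spectrum (discrete_uniform A) L" "L \<subseteq> \<int>"
  shows "finite_spectrum (fourier_transform (discrete_uniform A)) L"
proof -
  let ?\<mu> = "discrete_uniform A"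
  have \<mu>: "real_distribution ?\<mu>" by (rule real_distribution_discrete_uniform)
  have fin: "finite L" using A L(1) by (rule spectrum_discrete_uniform_finite)
  have orth: "\<And>l l'. l \<in> L \<Longrightarrow> l' \<in> L \<Longrightarrow> l \<noteq> l' \<Longrightarrow> fourier_transform ?\<mu> (l - l') = 0"
    and appr: "\<And>\<xi>. approximable ?\<mu> L wave (wave \<xi>)"
    using L(1) square_integrable_wave[OF \<mu>] unfolding is_spectrum_iff_approximable[OF \<mu>] by blast+
  have "(\<Sum>l\<in>L. (cmod (fourier_transform ?\<mu> (l - \<xi>)))\<^sup>2) = 1" (is "?S = 1") for \<xi>
  proof (rule antisym)
    show "?S \<le> 1" by (rule Bessel_fourier_transform[OF \<mu> fin orth])
    show "1 \<le> ?S"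
    proof (rule field_le_epsilon)
      fix \<epsilon> :: real assume "\<epsilon> > 0"
      then obtain F c where F: "finite F" "F \<subseteq> L"
        "(\<integral>x. (cmod (wave \<xi> x - (\<Sum>l\<in>F. c l * wave l x)))\<^sup>2 \<partial>?\<mu>) < \<epsilon>"
        using appr[of \<xi>] unfolding approximable_def by meson
      have "1 - (\<Sum>l\<in>F. (cmod (fourier_transform ?\<mu> (l - \<xi>)))\<^sup>2) \<le>
         (\<integral>x. (cmod (wave \<xi> x - (\<Sum>l\<in>F. c l * wave l x)))\<^sup>2 \<partial>?\<mu>)"
        using F(2) by (subst L2_norm_wave_diff_orthogonal[OF \<mu> F(1)]) (auto intro!: orth sum_nonneg)
      moreover have "(\<Sum>l\<in>F. (cmod (fourier_transform ?\<mu> (l - \<xi>)))\<^sup>2) \<le> ?S"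
        using fin F(2) by (intro sum_mono2) auto
      ultimately show "1 \<le> ?S + \<epsilon>" using F(3) by linarith
    qed
  qed
  then show ?thesis unfolding finite_spectrum_def using fin L(2) orth by blast
qed

lemma finite_spectrum_translate:
  assumes "finite_spectrum \<phi> L" "c \<in> \<int>"
  shows "finite_spectrum \<phi> ((\<lambda>l. l - c) ` L)"
proof -
  have "(\<Sum>l\<in>(\<lambda>l. l - c) ` L. (cmod (\<phi> (l - \<xi>)))\<^sup>2) = 1" for \<xi>
    using assms(1) by (subst sum.reindex) (auto simp: finite_spectrum_def inj_on_def diff_diff_eq)
  then show ?thesis using assms unfolding finite_spectrum_def by (auto intro: Ints_diff)
qed

section \<open>From spectra of single factors to spectra of partial convolutions\<close>

context admissible_sequence
begin

text \<open>Translating a spectrum by one of its own elements puts 0 into it; this is what later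
  makes an extended spectrum contain the old one. The Parseval sum being 1 excludes the empty
  set.\<close>

lemma ex_mask_spectrum:
  assumes "k \<ge> 1"
  shows "\<exists>L. finite_spectrum (mask k) L \<and> 0 \<in> L"
proof -
  obtain L where L: "L \<subseteq> \<int>" "is_spectrum (discrete_uniform ((\<lambda>b. of_int b / of_int (N k)) ` B k)) L"
    using admissible[OF assms] by (auto simp: admissible_pair_def)
  have spec: "finite_spectrum (mask k) L"
    unfolding mask_def using finite_digits[OF assms] digits_nonempty[OF assms] L
    by (intro finite_spectrum_discrete_uniform) auto
  then have "L \<noteq> {}" by (auto simp: finite_spectrum_def)
  then obtain l where "l \<in> L" by blast
  with spec L(1) show ?thesis
    by (intro exI[of _ "(\<lambda>x. x - l) ` L"]) (auto intro!: finite_spectrum_translate image_eqI[of _ _ l])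
qed

text \<open>The digits are integers, so the exponents change by integer multiples of 2 pi i.\<close>

lemma mask_periodic:
  assumes "k \<ge> 1"
  shows "mask k (x + of_int (N k * j)) = mask k x"
proof -
  have "exp (- 2 * of_real pi * \<i> * of_real ((x + of_int (N k * j)) * (b / N k))) =
      exp (- 2 * of_real pi * \<i> * of_real (x * (b / N k)))" for b :: int
  proof -
    have "(x + of_int (N k * j)) * (b / N k) = x * (b / N k) + of_int (j * b)"
      using base_nonzero[OF assms] by (simp add: field_simps)
    then have "exp (- 2 * of_real pi * \<i> * of_real ((x + of_int (N k * j)) * (b / N k))) =
      exp (- 2 * of_real pi * \<i> * of_real (x * (b / N k)) + \<i> * (of_int (- (j * b)) * (of_real pi * 2)))"
      by (simp add: algebra_simps)
    then show ?thesis by (simp only: exp_plus_2pin)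
  qed
  then show ?thesis unfolding mask_eq[OF assms] by presburger
qed

lemma partial_periodic:
  "fourier_transform (partial n m) (x + of_int (scale n m * j)) = fourier_transform (partial n m) x"
proof (induction m arbitrary: j)
  case (Suc m)
  have "scale n (Suc m) * j = scale n m * (N (n + Suc m) * j)" by (simp add: scale_Suc)
  moreover have "(x + of_int (scale n m * (N (n + Suc m) * j))) / scale n m = x / scale n m + of_int (N (n + Suc m) * j)"
    by (simp add: add_divide_distrib)
  ultimately show ?case
    using mask_periodic[of "n + Suc m" "x / scale n m" j]
    by (simp only: fourier_transform_partial_Suc Suc.IH)
qed simp

abbreviation partial_spectrum :: "nat \<Rightarrow> real set \<Rightarrow> bool" where
  "partial_spectrum n \<equiv> finite_spectrum (fourier_transform (partial 0 n))"

text \<open>Were the points distinct, the transform at their difference would be 0 by orthogonality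
  and, being P_n-periodic, 1.\<close>

lemma partial_spectrum_separated:
  assumes "partial_spectrum n \<Lambda>" "l \<in> \<Lambda>" "l' \<in> \<Lambda>" "l - l' = of_int (scale 0 n * j)"
  shows "l = l'"
proof (rule ccontr)
  assume "l \<noteq> l'"
  then have "fourier_transform (partial 0 n) (0 + of_int (scale 0 n * j)) = 0"
    using assms unfolding finite_spectrum_def by (metis add_0)
  then show False
    unfolding partial_periodic by (simp add: fourier_transform_0 real_distribution_partial)
qed

text \<open>All arguments of the transform change by multiples of its period P_n, so sums and zeros
  are untouched; separation guarantees that no two points merge.\<close>

lemma partial_spectrum_shift:
  assumes \<Lambda>: "partial_spectrum n \<Lambda>"
  shows "partial_spectrum n ((\<lambda>l. l + of_int (scale 0 n * k l)) ` \<Lambda>)"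
proof -
  let ?s = "\<lambda>l. l + of_int (scale 0 n * k l)"
  have inj: "inj_on ?s \<Lambda>"
  proof (rule inj_onI)
    fix l l' assume "l \<in> \<Lambda>" "l' \<in> \<Lambda>" "?s l = ?s l'"
    moreover from this have "l - l' = of_int (scale 0 n * (k l' - k l))" by (simp add: algebra_simps)
    ultimately show "l = l'" using partial_spectrum_separated[OF \<Lambda>] by blast
  qed
  have per: "fourier_transform (partial 0 n) (?s l - x) = fourier_transform (partial 0 n) (l - x)" for l x
    using partial_periodic[of 0 n "l - x" "k l"] by (simp add: algebra_simps)
  have per': "fourier_transform (partial 0 n) (x - ?s l) = fourier_transform (partial 0 n) (x - l)" for l x
    using partial_periodic[of 0 n "x - l" "- k l"] by (simp add: algebra_simps)
  have "(\<Sum>l\<in>?s ` \<Lambda>. (cmod (fourier_transform (partial 0 n) (l - \<xi>)))\<^sup>2) = 1" for \<xi>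
    using \<Lambda> unfolding sum.reindex[OF inj] comp_def per finite_spectrum_def by blast
  moreover have "fourier_transform (partial 0 n) (l - l') = 0" if l_l': "l \<in> ?s ` \<Lambda>" "l' \<in> ?s ` \<Lambda>" "l \<noteq> l'" for l l'
  proof -
    obtain a b where "l = ?s a" "l' = ?s b" "a \<in> \<Lambda>" "b \<in> \<Lambda>" "a \<noteq> b" using l_l' by blast
    then show ?thesis using \<Lambda> unfolding finite_spectrum_def by (simp only: per per') blast
  qed
  ultimately show ?thesis
    using \<Lambda> unfolding finite_spectrum_def by (auto intro!: Ints_add)
qed

text \<open>The new spectrum is the set of sums a + P_n l. In the Parseval sum the old factor does
  not depend on \<open>l\<close> by periodicity, so the sum over \<open>l\<close> is that of the
  mask and equals 1, and the sum over \<open>a\<close> follows. Two distinct points are orthogonal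
  by the old factor if their \<open>a\<close> differ and by the mask otherwise.\<close>

lemma partial_spectrum_Suc:
  assumes \<Lambda>: "partial_spectrum n \<Lambda>"
  shows "\<exists>\<Lambda>'. \<Lambda> \<subseteq> \<Lambda>' \<and> partial_spectrum (Suc n) \<Lambda>'"
proof -
  obtain L where L: "finite_spectrum (mask (Suc n)) L" "0 \<in> L"
    using ex_mask_spectrum[of "Suc n"] by auto
  define P where "P = real_of_int (scale 0 n)"
  have "P \<noteq> 0" by (simp add: P_def)
  let ?s = "\<lambda>(a, l). a + P * l"
  have ft: "fourier_transform (partial 0 (Suc n)) x = fourier_transform (partial 0 n) x * mask (Suc n) (x / P)" for x
    using fourier_transform_partial_Suc[of 0 n x] by (simp add: P_def)
  have per: "fourier_transform (partial 0 n) (x + P * l) = fourier_transform (partial 0 n) x" if "l \<in> \<int>" for x l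
    using that partial_periodic[of 0 n x] by (auto simp: P_def elim!: Ints_cases)
  have sep: "a = a' \<and> l = l'" if "a \<in> \<Lambda>" "a' \<in> \<Lambda>" "l \<in> L" "l' \<in> L" "a + P * l = a' + P * l'" for a a' l l'
  proof -
    have "l' - l \<in> \<int>" using that L(1) by (auto simp: finite_spectrum_def intro!: Ints_diff)
    then obtain j where j: "l' - l = of_int j" by (rule Ints_cases)
    have "a - a' = P * (l' - l)" using that(5) by (simp add: algebra_simps)
    then have "a = a'" using partial_spectrum_separated[OF \<Lambda> that(1,2), of j] j by (simp add: P_def)
    with that(5) \<open>P \<noteq> 0\<close> show ?thesis by simp
  qed
  have inj: "inj_on ?s (\<Lambda> \<times> L)" using sep by (auto simp: inj_on_def)
  have "(\<Sum>x\<in>?s ` (\<Lambda> \<times> L). (cmod (fourier_transform (partial 0 (Suc n)) (x - \<xi>)))\<^sup>2) = 1" for \<xi>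
  proof -
    have eq: "fourier_transform (partial 0 (Suc n)) (a + P * l - \<xi>) =
        fourier_transform (partial 0 n) (a - \<xi>) * mask (Suc n) (l - (\<xi> - a) / P)" if "l \<in> L" for a l
    proof -
      have "l \<in> \<int>" using that L(1) by (auto simp: finite_spectrum_def)
      moreover have "(a + P * l - \<xi>) / P = l - (\<xi> - a) / P" using \<open>P \<noteq> 0\<close> by (simp add: field_simps)
      moreover have "a + P * l - \<xi> = (a - \<xi>) + P * l" by simp
      ultimately show ?thesis unfolding ft by (metis per)
    qed
    have "(\<Sum>x\<in>?s ` (\<Lambda> \<times> L). (cmod (fourier_transform (partial 0 (Suc n)) (x - \<xi>)))\<^sup>2) =
       (\<Sum>a\<in>\<Lambda>. \<Sum>l\<in>L. (cmod (fourier_transform (partial 0 (Suc n)) (a + P * l - \<xi>)))\<^sup>2)"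
      unfolding sum.reindex[OF inj] by (simp add: sum.cartesian_product case_prod_unfold)
    also have "\<dots> = (\<Sum>a\<in>\<Lambda>. (cmod (fourier_transform (partial 0 n) (a - \<xi>)))\<^sup>2 *
        (\<Sum>l\<in>L. (cmod (mask (Suc n) (l - (\<xi> - a) / P)))\<^sup>2))"
      by (simp add: eq norm_mult power_mult_distrib sum_distrib_left)
    also have "\<dots> = 1" using L(1) \<Lambda> by (simp add: finite_spectrum_def)
    finally show ?thesis .
  qed
  moreover have "fourier_transform (partial 0 (Suc n)) (x - y) = 0"
    if x_y_in: "x \<in> ?s ` (\<Lambda> \<times> L)" "y \<in> ?s ` (\<Lambda> \<times> L)" "x \<noteq> y" for x y
  proof -
    obtain a l a' l' where xy: "x = a + P * l" "y = a' + P * l'" "a \<in> \<Lambda>" "a' \<in> \<Lambda>" "l \<in> L" "l' \<in> L" using x_y_in(1,2) by auto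
    have int: "l - l' \<in> \<int>" using xy L(1) by (auto simp: finite_spectrum_def intro!: Ints_diff)
    have x_y: "x - y = (a - a') + P * (l - l')" by (simp add: xy algebra_simps)
    show ?thesis
    proof (cases "a = a'")
      case True
      then have "l \<noteq> l'" using xy that by auto
      then have "mask (Suc n) (l - l') = 0"
        using L(1) xy by (simp add: finite_spectrum_def)
      moreover have "(x - y) / P = l - l'" using True \<open>P \<noteq> 0\<close> unfolding x_y by simp
      ultimately have "mask (Suc n) ((x - y) / P) = 0" by simp
      then show ?thesis by (simp add: ft)
    next
      case False
      then have "fourier_transform (partial 0 n) (x - y) = 0"
        unfolding x_y per[OF int] using \<Lambda> xy by (simp add: finite_spectrum_def)
      then show ?thesis by (simp add: ft)
    qed
  qed
  moreover have "?s ` (\<Lambda> \<times> L) \<subseteq> \<int>"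
    using \<Lambda> L(1) unfolding finite_spectrum_def by (auto simp: P_def intro!: Ints_add Ints_mult)
  moreover have "finite (?s ` (\<Lambda> \<times> L))" using \<Lambda> L(1) by (simp add: finite_spectrum_def)
  ultimately have "partial_spectrum (Suc n) (?s ` (\<Lambda> \<times> L))"
    unfolding finite_spectrum_def by blast
  moreover have "\<Lambda> \<subseteq> ?s ` (\<Lambda> \<times> L)"
    using L(2) by (force intro: image_eqI[of _ _ "(_, 0)"])
  ultimately show ?thesis by blast
qed

lemma partial_spectrum_extend:
  assumes "partial_spectrum n \<Lambda>" "n \<le> m"
  shows "\<exists>\<Lambda>'. \<Lambda> \<subseteq> \<Lambda>' \<and> partial_spectrum m \<Lambda>'"
  using assms(2)
proof (induction m rule: dec_induct)
  case base
  show ?case using assms(1) by blast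
next
  case (step m)
  then show ?case using partial_spectrum_Suc by (meson order_trans)
qed

lemma ex_partial_spectrum: "\<exists>\<Lambda>. partial_spectrum n \<Lambda>"
proof -
  have "partial_spectrum 0 {0}" by (simp add: finite_spectrum_def)
  then show ?thesis using partial_spectrum_extend[of 0 "{0}" n] by auto
qed

end

section \<open>Passage to the limit\<close>

context convergent_admissible_sequence
begin

lemma orthogonal_of_partial_spectrum:
  assumes "partial_spectrum n \<Lambda>" "l \<in> \<Lambda>" "l' \<in> \<Lambda>" "l \<noteq> l'"
  shows "fourier_transform \<mu> (l - l') = 0"
  using assms fourier_transform_tail[of "l - l'" n] by (simp add: finite_spectrum_def)

text \<open>The products grow at least like powers of 2, and \<open>n k\<close> is at least
  \<open>k\<close>. Used for the test frequency and for the elements of an old spectrum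
  alike.\<close>

lemma scale_eventually_large:
  fixes C \<delta> :: real
  assumes "strict_mono n" "\<delta> > 0"
  shows "\<forall>\<^sub>F k in sequentially. \<bar>C / scale 0 (n k)\<bar> < \<delta>"
proof -
  obtain m where m: "\<bar>C\<bar> / \<delta> < 2 ^ m" using real_arch_pow[of 2 "\<bar>C\<bar> / \<delta>"] by auto
  show ?thesis
  proof (rule eventually_sequentiallyI[of m])
    fix k assume "m \<le> k"
    then have "(2::real) ^ m \<le> 2 ^ n k"
      using seq_suble[OF assms(1), of k] by (intro power_increasing) auto
    also have "\<dots> \<le> \<bar>real_of_int (scale 0 (n k))\<bar>"
      using abs_scale_ge[of "n k" 0, folded of_int_le_iff[where 'a=real]] by simp
    finally have "\<bar>C\<bar> / \<delta> < \<bar>real_of_int (scale 0 (n k))\<bar>" using m by linarith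
    then show "\<bar>C / scale 0 (n k)\<bar> < \<delta>"
      using \<open>\<delta> > 0\<close> by (simp add: pos_divide_less_eq mult.commute)
  qed
qed

text \<open>\<open>S \<xi> k\<close> is the Parseval sum of \<mu> over \<open>L k\<close> and
  increases to some \<open>Q\<close>; the point is \<open>Q = 1\<close>. In the identity for the
  partial convolution both the summands and the index set vary with \<open>k\<close>, so it is split
  at a fixed \<open>L i\<close>: there the limit is taken termwise, while the rest is dominated by
  \<open>(S \<xi> k - S \<xi> i) / \<epsilon>\<^sup>2\<close>. First \<open>k\<close> and then
  \<open>i\<close> tends to infinity.\<close>

lemma is_spectrum_Union:
  assumes n: "strict_mono n" and mono: "incseq L" and spec: "\<And>k. partial_spectrum (n k) (L k)"
    and "\<epsilon> > 0" "\<delta> > 0"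
    and below: "\<And>k l y. l \<in> L k \<Longrightarrow> \<bar>y\<bar> < \<delta> \<Longrightarrow> \<epsilon> \<le> cmod (fourier_transform (tail (n k)) (l / scale 0 (n k) + y))"
  shows "is_spectrum \<mu> (\<Union>k. L k)"
proof -
  let ?\<Lambda> = "\<Union>k. L k"
  have fin: "finite (L k)" for k using spec[of k] by (simp add: finite_spectrum_def)
  have orth: "fourier_transform \<mu> (l - l') = 0" if ll': "l \<in> ?\<Lambda>" "l' \<in> ?\<Lambda>" "l \<noteq> l'" for l l'
  proof -
    obtain i j where "l \<in> L i" "l' \<in> L j" using ll' by blast
    then have "l \<in> L (max i j)" "l' \<in> L (max i j)"
      using incseqD[OF mono, of i "max i j"] incseqD[OF mono, of j "max i j"] by auto
    then show ?thesis using orthogonal_of_partial_spectrum[OF spec] ll'(3) by blast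
  qed
  define S where "S \<xi> k = (\<Sum>l\<in>L k. (cmod (fourier_transform \<mu> (l - \<xi>)))\<^sup>2)" for \<xi> k
  have S_le: "S \<xi> k \<le> 1" for \<xi> k
    unfolding S_def by (rule Bessel_fourier_transform[OF real_distribution_limit fin]) (rule orth, auto)
  have S_mono: "incseq (S \<xi>)" for \<xi>
    unfolding S_def incseq_def using incseqD[OF mono] by (intro allI impI sum_mono2 fin) auto
  have S_lim: "S \<xi> \<longlonglongrightarrow> 1" for \<xi>
  proof -
    obtain Q where Q: "S \<xi> \<longlonglongrightarrow> Q" "\<And>k. S \<xi> k \<le> Q"
      using incseq_convergent[OF S_mono] S_le by blast
    have "1 \<le> S \<xi> i + (Q - S \<xi> i) / \<epsilon>\<^sup>2" for i
    proof (rule tendsto_le[OF sequentially_bot])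
      let ?\<phi> = "\<lambda>k l. (cmod (fourier_transform (partial 0 (n k)) (l - \<xi>)))\<^sup>2"
      have "(\<lambda>k. fourier_transform (partial 0 (n k)) x) \<longlonglongrightarrow> fourier_transform \<mu> x" for x
        by (rule filterlim_compose[OF fourier_transform_partial_tendsto filterlim_subseq[OF n]])
      then show "(\<lambda>k. (\<Sum>l\<in>L i. ?\<phi> k l) + (S \<xi> k - S \<xi> i) / \<epsilon>\<^sup>2) \<longlonglongrightarrow> S \<xi> i + (Q - S \<xi> i) / \<epsilon>\<^sup>2"
        using \<open>\<epsilon> > 0\<close> Q(1) unfolding S_def[of _ i] by (intro tendsto_intros) auto
      \<comment> \<open>The test frequency is absorbed by the window of \<open>below\<close>, taken
        at \<open>y = - \<xi> / scale 0 (n k)\<close>.\<close>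
      have "\<forall>\<^sub>F k in sequentially. \<bar>- \<xi> / scale 0 (n k)\<bar> < \<delta>"
        using n \<open>\<delta> > 0\<close> by (rule scale_eventually_large)
      then show "\<forall>\<^sub>F k in sequentially. 1 \<le> (\<Sum>l\<in>L i. ?\<phi> k l) + (S \<xi> k - S \<xi> i) / \<epsilon>\<^sup>2"
        using eventually_ge_at_top[of i]
      proof eventually_elim
        case (elim k)
        have sub: "L i \<subseteq> L k" using elim(2) incseqD[OF mono] by blast
        have "?\<phi> k l \<le> (cmod (fourier_transform \<mu> (l - \<xi>)))\<^sup>2 / \<epsilon>\<^sup>2" if "l \<in> L k" for l
        proof -
          have "(l - \<xi>) / scale 0 (n k) = l / scale 0 (n k) + - \<xi> / scale 0 (n k)"
            by (simp add: diff_divide_distrib)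
          then have "\<epsilon> \<le> cmod (fourier_transform (tail (n k)) ((l - \<xi>) / scale 0 (n k)))"
            using below[OF that elim(1)] by simp
          then have "\<epsilon>\<^sup>2 \<le> (cmod (fourier_transform (tail (n k)) ((l - \<xi>) / scale 0 (n k))))\<^sup>2"
            using \<open>\<epsilon> > 0\<close> by (intro power_mono) auto
          then have "?\<phi> k l * \<epsilon>\<^sup>2 \<le> ?\<phi> k l * (cmod (fourier_transform (tail (n k)) ((l - \<xi>) / scale 0 (n k))))\<^sup>2"
            by (intro mult_left_mono) auto
          also have "\<dots> = (cmod (fourier_transform \<mu> (l - \<xi>)))\<^sup>2"
            by (simp add: fourier_transform_tail[of "l - \<xi>" "n k"] norm_mult power_mult_distrib)
          finally show ?thesis using \<open>\<epsilon> > 0\<close> by (simp add: pos_le_divide_eq)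
        qed
        then have "(\<Sum>l\<in>L k - L i. ?\<phi> k l) \<le> (\<Sum>l\<in>L k - L i. (cmod (fourier_transform \<mu> (l - \<xi>)))\<^sup>2 / \<epsilon>\<^sup>2)"
          by (intro sum_mono) auto
        also have "\<dots> = (S \<xi> k - S \<xi> i) / \<epsilon>\<^sup>2"
          unfolding S_def sum_divide_distrib[symmetric] sum_diff[OF fin sub] ..
        finally have "(\<Sum>l\<in>L k - L i. ?\<phi> k l) \<le> (S \<xi> k - S \<xi> i) / \<epsilon>\<^sup>2" .
        moreover have "(\<Sum>l\<in>L k. ?\<phi> k l) = 1" using spec[of k] by (simp add: finite_spectrum_def)
        ultimately show ?case using sum.subset_diff[OF sub fin, of "?\<phi> k"] by linarith
      qed
    qed (rule tendsto_const)
    \<comment> \<open>Now \<open>i\<close> tends to infinity and the remainder disappears, however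
      small \<epsilon> is.\<close>
    then have "1 \<le> Q + (Q - Q) / \<epsilon>\<^sup>2"
      using \<open>\<epsilon> > 0\<close> by (intro tendsto_le[OF sequentially_bot _ tendsto_const[of 1], of "\<lambda>i. S \<xi> i + (Q - S \<xi> i) / \<epsilon>\<^sup>2"] tendsto_intros Q always_eventually) auto
    moreover have "Q \<le> 1" using S_le by (intro LIMSEQ_le_const2[OF Q(1)]) auto
    ultimately show ?thesis using Q(1) by simp
  qed
  have "approximable \<mu> ?\<Lambda> wave (wave \<xi>)" for \<xi>
    unfolding approximable_def
  proof (intro allI impI)
    fix \<eta> :: real assume "\<eta> > 0"
    then have "\<forall>\<^sub>F k in sequentially. 1 - \<eta> < S \<xi> k" by (intro order_tendstoD(1)[OF S_lim]) simp
    then obtain k where "1 - \<eta> < S \<xi> k" by (auto simp: eventually_sequentially)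
    \<comment> \<open>The transform values are the optimal coefficients, for which the error is
      exactly the deficit in Parseval's identity.\<close>
    moreover have "(\<integral>x. (cmod (wave \<xi> x - (\<Sum>l\<in>L k. fourier_transform \<mu> (l - \<xi>) * wave l x)))\<^sup>2 \<partial>\<mu>) = 1 - S \<xi> k"
      unfolding S_def by (subst L2_norm_wave_diff_orthogonal[OF real_distribution_limit fin]) (auto intro!: orth)
    ultimately have "(\<integral>x. (cmod (wave \<xi> x - (\<Sum>l\<in>L k. fourier_transform \<mu> (l - \<xi>) * wave l x)))\<^sup>2 \<partial>\<mu>) < \<eta>"
      by simp
    with fin show "\<exists>F c. finite F \<and> F \<subseteq> ?\<Lambda> \<and> (\<integral>x. (cmod (wave \<xi> x - (\<Sum>l\<in>F. c l * wave l x)))\<^sup>2 \<partial>\<mu>) < \<eta>"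
      by (intro exI[of _ "L k"] exI[of _ "\<lambda>l. fourier_transform \<mu> (l - \<xi>)"]) blast
  qed
  then interpret L2_wave_family \<mu> ?\<Lambda> wave
    by (intro L2_wave_family.intro L2_family.intro L2_wave_family_axioms.intro
      real_distribution_limit square_integrable_wave)
  show ?thesis
    unfolding is_spectrum_iff_approximable[OF real_distribution_limit]
    using orth approximable_square_integrable by blast
qed

lemma ex_spectrum:
  assumes s: "strict_mono s" and \<nu>: "real_distribution \<nu>" "weakly_converges (\<lambda>j. tail (s j)) \<nu>"
    and Z: "integral_periodic_zero_set \<nu> = {}"
  shows "\<exists>\<Lambda>. \<Lambda> \<subseteq> \<int> \<and> is_spectrum \<mu> \<Lambda>"
proof -
  obtain \<epsilon> \<delta> where pos: "\<epsilon> > 0" "\<delta> > 0" and ev: "\<forall>\<^sub>F j in sequentially.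
    (\<forall>x. \<exists>k::int. \<forall>y. \<bar>y\<bar> < \<delta> \<longrightarrow> \<epsilon> \<le> cmod (fourier_transform (tail (s j)) (x + k + y))) \<and>
    (\<forall>y. \<bar>y\<bar> < \<delta> \<longrightarrow> \<epsilon> \<le> cmod (fourier_transform (tail (s j)) y))"
    using fourier_transform_equipositive[OF real_distribution_tail \<nu> Z] by blast
  \<comment> \<open>The window is \<delta> / 2: for unmoved elements the other half of \<delta> is
    taken up by their distance from 0 after rescaling.\<close>
  define good where "good j L \<longleftrightarrow> partial_spectrum (s j) L \<and> (\<forall>l\<in>L. \<forall>y. \<bar>y\<bar> < \<delta> / 2 \<longrightarrow>
    \<epsilon> \<le> cmod (fourier_transform (tail (s j)) (l / scale 0 (s j) + y)))" for j L
  have step: "\<exists>j L'. j > i \<and> L \<subseteq> L' \<and> good j L'" if L: "partial_spectrum n L" for n i L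
  proof -
    have "finite L" using L by (simp add: finite_spectrum_def)
    \<comment> \<open>\<open>L\<close> is finite, so all sufficiently large \<open>j\<close> serve
      all its elements simultaneously.\<close>
    then have small: "\<forall>\<^sub>F j in sequentially. \<forall>l\<in>L. \<bar>l / scale 0 (s j)\<bar> < \<delta> / 2"
      using pos by (intro eventually_ball_finite scale_eventually_large[OF s] ballI) auto
    \<comment> \<open>\<open>n\<close> ensures \<open>n \<le> s j\<close>, needed to extend from
      level \<open>n\<close>; \<open>Suc i\<close> makes the index grow strictly.\<close>
    have "\<forall>\<^sub>F j in sequentially. j \<ge> max n (Suc i)" by (rule eventually_ge_at_top)
    with ev small have "\<forall>\<^sub>F j in sequentially. \<exists>L'. j > i \<and> L \<subseteq> L' \<and> good j L'"
    proof eventually_elim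
      case (elim j)
      have "n \<le> s j" using elim(3) seq_suble[OF s, of j] by simp
      then obtain L1 where L1: "L \<subseteq> L1" "partial_spectrum (s j) L1"
        using partial_spectrum_extend[OF L] by blast
      \<comment> \<open>The move is 0 on \<open>L\<close>, so that the new set contains the old one;
        all other elements receive the integer from equipositivity.\<close>
      have "\<forall>l. \<exists>k::int. (l \<in> L \<longrightarrow> k = (0::int)) \<and> (\<forall>y. \<bar>y\<bar> < \<delta> / 2 \<longrightarrow>
          \<epsilon> \<le> cmod (fourier_transform (tail (s j)) (l / scale 0 (s j) + k + y)))"
      proof (intro allI)
        fix l
        show "\<exists>k::int. (l \<in> L \<longrightarrow> k = (0::int)) \<and> (\<forall>y. \<bar>y\<bar> < \<delta> / 2 \<longrightarrow>
          \<epsilon> \<le> cmod (fourier_transform (tail (s j)) (l / scale 0 (s j) + k + y)))"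
        proof (cases "l \<in> L")
          case True
          then have "\<bar>l / scale 0 (s j) + y\<bar> < \<delta>" if "\<bar>y\<bar> < \<delta> / 2" for y
          proof -
            have "\<bar>l / scale 0 (s j)\<bar> < \<delta> / 2" using elim(2) True by blast
            then show ?thesis using that by linarith
          qed
          then show ?thesis using elim(1) by (intro exI[of _ 0]) simp
        next
          case False
          obtain k :: int where k: "\<And>y. \<bar>y\<bar> < \<delta> \<Longrightarrow>
              \<epsilon> \<le> cmod (fourier_transform (tail (s j)) (l / scale 0 (s j) + k + y))"
            using elim(1) by blast
          have "\<bar>y\<bar> < \<delta>" if "\<bar>y\<bar> < \<delta> / 2" for y using that pos by linarith
          with k False show ?thesis by blast
        qed
      qed
      from choice[OF this] obtain k :: "real \<Rightarrow> int" where k: "l \<in> L \<longrightarrow> k l = 0"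
        "\<forall>y. \<bar>y\<bar> < \<delta> / 2 \<longrightarrow> \<epsilon> \<le> cmod (fourier_transform (tail (s j)) (l / scale 0 (s j) + k l + y))" for l
        by blast
      let ?L' = "(\<lambda>l. l + of_int (scale 0 (s j) * k l)) ` L1"
      have "L \<subseteq> ?L'" using L1(1) k(1) by force
      moreover have "(l + of_int (scale 0 (s j) * k l)) / scale 0 (s j) = l / scale 0 (s j) + k l" for l
        by (simp add: add_divide_distrib)
      then have "good j ?L'"
        unfolding good_def using partial_spectrum_shift[OF L1(2), of k] k(2) by simp
      moreover have "j > i" using elim(3) by simp
      ultimately show ?case by blast
    qed
    then show ?thesis by (auto simp: eventually_sequentially)
  qed
  \<comment> \<open>Dependent choice on pairs of an index into \<open>s\<close> and a spectrum at
    that level; strict growth of the index gives a subsequence.\<close>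
  have "\<exists>f. \<forall>k. good (fst (f k)) (snd (f k)) \<and> (fst (f k) < fst (f (Suc k)) \<and> snd (f k) \<subseteq> snd (f (Suc k)))"
  proof (rule dependent_nat_choice)
    obtain L where "partial_spectrum 0 L" using ex_partial_spectrum by blast
    from step[OF this] obtain j L' where "good j L'" by blast
    then show "\<exists>x. good (fst x) (snd x)" by (intro exI[of _ "(j, L')"]) simp
    fix x :: "nat \<times> real set" and k :: nat assume "good (fst x) (snd x)"
    then have "partial_spectrum (s (fst x)) (snd x)" by (simp add: good_def)
    from step[OF this, of "fst x"] obtain j L' where "fst x < j" "snd x \<subseteq> L'" "good j L'" by blast
    then show "\<exists>y. good (fst y) (snd y) \<and> (fst x < fst y \<and> snd x \<subseteq> snd y)"
      by (intro exI[of _ "(j, L')"]) simp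
  qed
  then obtain f where f: "\<And>k. good (fst (f k)) (snd (f k))" "\<And>k. fst (f k) < fst (f (Suc k))"
    "\<And>k. snd (f k) \<subseteq> snd (f (Suc k))" by blast
  define L where "L k = snd (f k)" for k
  have spec: "partial_spectrum (s (fst (f k))) (L k)" for k using f(1)[of k] by (simp add: good_def L_def)
  have "is_spectrum \<mu> (\<Union>k. L k)"
  proof (rule is_spectrum_Union[where n="\<lambda>k. s (fst (f k))"])
    show "strict_mono (\<lambda>k. s (fst (f k)))"
      using f(2) s by (intro strict_mono_Suc_iff[THEN iffD2]) (auto simp: strict_mono_less)
    show "incseq L" unfolding L_def using f(3) by (rule incseq_SucI)
    show "\<epsilon> > 0" "\<delta> / 2 > 0" using pos by simp_all
  qed (use spec f(1) in \<open>auto simp: good_def L_def\<close>)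
  moreover have "(\<Union>k. L k) \<subseteq> \<int>" using spec by (fastforce simp: finite_spectrum_def)
  ultimately show ?thesis by blast
qed

end

theorem theorem1p1:
  fixes N :: "nat \<Rightarrow> int" and B :: "nat \<Rightarrow> int set"
    and \<mu> \<nu> :: "real measure" and s :: "nat \<Rightarrow> nat"
  assumes "\<And>k. k \<ge> 1 \<Longrightarrow> admissible_pair (N k) (B k)"
    and "has_infinite_convolution (tail_factor N B 0) \<mu>"
    and "strict_mono s" and "\<And>j. s j \<ge> 1"
    and "real_distribution \<nu>"
    and "weakly_converges (\<lambda>j. infinite_convolution (tail_factor N B (s j))) \<nu>"
    and "integral_periodic_zero_set \<nu> = {}"
  shows "spectral_measure \<mu> \<and> (\<exists>\<Lambda>. \<Lambda> \<subseteq> \<int> \<and> is_spectrum \<mu> \<Lambda>)"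
proof -
  interpret convergent_admissible_sequence N B \<mu>
    using assms(1,2) by unfold_locales
  obtain \<Lambda> where "\<Lambda> \<subseteq> \<int>" "is_spectrum \<mu> \<Lambda>"
    using ex_spectrum[OF assms(3,5) _ assms(7)] assms(6) by (auto simp: tail_def)
  then show ?thesis
    using real_distribution_limit by (auto simp: spectral_measure_def)
qed

end
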